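(* Let $\zeta$ denote the Riemann zeta-function (meromorphic on $\mathbb{C}$ with its only pole at $z=1$), and let $S=\{z\in\mathbb{C}:\Re z=1/2\}$. There exist a sequence $(K_n)_{n\ge 1}$ of compact subsets of $\mathbb{C}$ with $K_n\subset K_{n+1}$ for all $n$ and $\bigcup_{n\ge1}K_n=\mathbb{C}$, a sequence $(P_n)_{n\ge1}$ of algebraic polynomials and a sequence $(D_n)_{n\ge1}$ of Dirichlet polynomials such that, for every $n\ge 1$, the following hold: (1) $\max\{|P_n(z)-\zeta(z)|,\,|D_n(z)-\zeta(z)|\}\le 1/n$ for all $z\in K_n\setminus\{1\}$; (2) $P_n(1)=D_n(1)=n$; (3) on $K_n\cap(\mathbb{R}\cup S)$, the functions $P_n$ and $D_n$ have only simple zeros, and these zeros are exactly the zeros of $\zeta$ lying in $K_n\cap(\mathbb{R}\cup S)$; (4) $P_n$ and $D_n$ have no zeros on $K_n\setminus(\mathbb{R}\cup S)$; (5) $P_n(\mathbb{R})\subset\mathbb{R}$ and $D_n(\mathbb{R})\subset\mathbb{R}$.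
   Context: An algebraic polynomial is an ordinary polynomial $P(z)=\sum_{n=0}^m a_n z^n$ with complex coefficients. A Dirichlet polynomial is a function of the form $D(z)=\sum_{n=1}^m \frac{a_n}{n^z}$ with complex coefficients $a_n$, where $n^{-z}=e^{-z\log n}$; it is an entire function of $z$. A zero is simple if it is a zero of order one of the entire function in question. *)

theory Defs
  imports "HOL-Complex_Analysis.Complex_Analysis"
begin

(* zeta is the analytic continuation to -{1} of the Dirichlet series; the value 0 at the pole
   s = 1 is a convention without meaning. *)
definition zeta_continuation :: "(complex \<Rightarrow> complex) \<Rightarrow> bool" where
  "zeta_continuation f \<longleftrightarrow>
     f holomorphic_on -{1} \<and>
     (\<forall>s. Re s > 1 \<longrightarrow> (\<lambda>n. 1 / of_nat (Suc n) powr s) sums f s) \<and>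
     f 1 = 0"

definition zeta :: "complex \<Rightarrow> complex" where
  "zeta = (THE f. zeta_continuation f)"

definition critical_line :: "complex set" where
  "critical_line = {z. Re z = 1/2}"

definition dirichlet_polynomial :: "(complex \<Rightarrow> complex) \<Rightarrow> bool" where
  "dirichlet_polynomial D \<longleftrightarrow>
     (\<exists>m (a :: nat \<Rightarrow> complex). D = (\<lambda>z. \<Sum>n=1..m. a n / of_nat n powr z))"

(* The rest of this theory shows that zeta_continuation determines a unique function. *)

lemma gbinomial_remainder_bound:
  fixes A :: real and K :: nat
  assumes "A \<ge> 0"
  obtains C where "C \<ge> 0"
    "\<And>(a::complex) x. norm a \<le> A \<Longrightarrow> 0 \<le> x \<Longrightarrow> x \<le> 1 \<Longrightarrow>
       norm ((1 + of_real x) powr a - (\<Sum>i\<le>K. (a gchoose i) * of_real x ^ i)) \<le> C * x ^ Suc K"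
proof
  let ?C = "(\<Prod>j<Suc K. A + real j) * 2 powr A / fact K"
  show "?C \<ge> 0" using assms by (auto intro!: divide_nonneg_nonneg mult_nonneg_nonneg prod_nonneg)
  fix a :: complex and x :: real
  assume a: "norm a \<le> A" and x: "0 \<le> x" "x \<le> 1"
  define f where "f = (\<lambda>i z. (\<Prod>j<i. a - of_nat j) * (1 + z) powr (a - of_nat i))"
  let ?S = "closed_segment 0 (1::complex)"
  have S: "\<exists>t. z = of_real t \<and> 0 \<le> t \<and> t \<le> 1" if "z \<in> ?S" for z
    using that by (auto simp: closed_segment_def scaleR_conv_of_real)
  have "norm (f 0 (of_real x) - (\<Sum>i\<le>K. f i 0 * (of_real x - 0) ^ i / fact i))
          \<le> ((\<Prod>j<Suc K. A + real j) * 2 powr A) * norm (of_real x - 0 :: complex) ^ Suc K / fact K"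
  proof (rule complex_Taylor[of ?S])
    fix i z assume "z \<in> ?S"
    then obtain t where t: "z = of_real t" "0 \<le> t" "t \<le> 1" using S by blast
    have "1 + z \<notin> \<real>\<^sub>\<le>\<^sub>0" using t by (auto simp: complex_nonpos_Reals_iff)
    then show "(f i has_field_derivative f (Suc i) z) (at z within ?S)"
    proof -
      have "((\<lambda>z. z powr (a - of_nat i)) has_field_derivative
               (a - of_nat i) * (1 + z) powr (a - of_nat i - 1)) (at (1 + z))"
        using \<open>1 + z \<notin> \<real>\<^sub>\<le>\<^sub>0\<close> by (rule has_field_derivative_powr)
      then have "((\<lambda>z. (1 + z) powr (a - of_nat i)) has_field_derivative
               (a - of_nat i) * (1 + z) powr (a - of_nat i - 1)) (at z)"
        using DERIV_shift[of "\<lambda>z. z powr (a - of_nat i)" _ z 1] by (simp add: add.commute)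
      then have "((\<lambda>z. (\<Prod>j<i. a - of_nat j) * (1 + z) powr (a - of_nat i)) has_field_derivative
               (\<Prod>j<i. a - of_nat j) * ((a - of_nat i) * (1 + z) powr (a - of_nat i - 1))) (at z)"
        by (rule DERIV_cmult)
      moreover have "a - of_nat i - 1 = a - of_nat (Suc i)" by simp
      ultimately show ?thesis
        unfolding f_def prod.lessThan_Suc
        by (metis has_field_derivative_at_within mult.assoc)
    qed
  next
    fix z assume "z \<in> ?S"
    then obtain t where t: "z = of_real t" "0 \<le> t" "t \<le> 1" using S by blast
    have 1: "norm (\<Prod>j<Suc K. a - of_nat j) \<le> (\<Prod>j<Suc K. A + real j)"
      unfolding prod_norm[symmetric]
    proof (rule prod_mono, safe)
      fix j
      have "norm (a - of_nat j) \<le> norm a + norm (of_nat j :: complex)" by (rule norm_triangle_ineq4)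
      then show "norm (a - of_nat j) \<le> A + real j" using a by simp
    qed auto
    have "norm ((1 + z) powr (a - of_nat (Suc K))) = (1 + t) powr (Re a - real (Suc K))"
      using t by (subst norm_powr_real_powr) auto
    also have "\<dots> \<le> (1 + t) powr A"
      using t a complex_Re_le_cmod[of a] by (intro powr_mono) auto
    also have "\<dots> \<le> 2 powr A" using t assms by (intro powr_mono2) auto
    finally show "norm (f (Suc K) z) \<le> (\<Prod>j<Suc K. A + real j) * 2 powr A"
      unfolding f_def norm_mult using 1 assms
      by (intro mult_mono prod_nonneg) auto
  next
    show "complex_of_real x \<in> ?S"
      using x by (auto simp: closed_segment_def scaleR_conv_of_real)
  qed auto
  moreover have "f i 0 * of_real x ^ i / fact i = (a gchoose i) * of_real x ^ i" for i
    by (simp add: f_def gbinomial_prod_rev atLeast0LessThan)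
  ultimately show "norm ((1 + of_real x) powr a - (\<Sum>i\<le>K. (a gchoose i) * of_real x ^ i)) \<le> ?C * x ^ Suc K"
    using x by (simp add: f_def)
qed

definition zeta_step :: "nat \<Rightarrow> nat \<Rightarrow> complex \<Rightarrow> complex" where
  "zeta_step M n s = of_nat (Suc n) powr (1 - s) - of_nat (Suc (Suc n)) powr (1 - s)
     + (\<Sum>j\<le>M. ((1 - s) gchoose Suc j) * of_nat (Suc n) powr (- (s + of_nat j)))"

lemma zeta_step_bound:
  fixes A :: real and M :: nat
  assumes "A \<ge> 0"
  obtains C where "C \<ge> 0"
    "\<And>s n. norm (1 - s) \<le> A \<Longrightarrow> norm (zeta_step M n s) \<le> C * real (Suc n) powr (- Re s - real (Suc M))"
proof -
  obtain C where C: "C \<ge> 0"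
    "\<And>(a::complex) x. norm a \<le> A \<Longrightarrow> 0 \<le> x \<Longrightarrow> x \<le> 1 \<Longrightarrow>
       norm ((1 + of_real x) powr a - (\<Sum>i\<le>Suc M. (a gchoose i) * of_real x ^ i)) \<le> C * x ^ Suc (Suc M)"
    by (rule gbinomial_remainder_bound[OF assms, where K = "Suc M"]) blast
  show ?thesis
  proof (rule that[OF C(1)])
    fix s :: complex and n assume s: "norm (1 - s) \<le> A"
    define N where "N = real (Suc n)"
    have N: "N \<ge> 1" by (simp add: N_def)
    let ?N = "complex_of_real N"
    have N0: "?N \<noteq> 0" using N by auto
    have c: "of_nat (Suc n) = ?N" "of_nat (Suc (Suc n)) = ?N + 1"
      by (simp_all add: N_def)
    have e1: "(?N + 1) powr (1 - s) = ?N powr (1 - s) * (1 + of_real (1 / N)) powr (1 - s)"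
    proof -
      have "?N + 1 = of_real N * of_real (1 + 1 / N)"
        using N by (simp add: field_simps flip: of_real_mult of_real_add)
      then show ?thesis using N
        by (simp only: powr_times_real[of "of_real N" "of_real (1 + 1/N)"]) 
           (auto simp: powr_times_real)
    qed
    have e2: "?N powr (- (s + of_nat j)) = ?N powr (1 - s) * of_real (1 / N) ^ Suc j" for j
    proof -
      have "?N powr (- (s + of_nat j)) = ?N powr ((1 - s) - of_nat (Suc j))"
        by (simp add: algebra_simps)
      also have "\<dots> = ?N powr (1 - s) / ?N ^ Suc j"
        using powr_diff[of ?N "1 - s" "of_nat (Suc j)"] powr_complexpow[OF N0, of "Suc j"]
        by (simp only:)
      finally show ?thesis by (simp add: power_one_over divide_inverse power_inverse)
    qed
    have "zeta_step M n s = - (?N powr (1 - s) * ((1 + of_real (1 / N)) powr (1 - s)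
            - (\<Sum>i\<le>Suc M. ((1 - s) gchoose i) * of_real (1 / N) ^ i)))"
      unfolding zeta_step_def c e1 e2 sum.atMost_Suc_shift
      by (simp add: algebra_simps sum_distrib_left sum_distrib_right)
    then have "norm (zeta_step M n s) = N powr (1 - Re s) * norm ((1 + of_real (1 / N)) powr (1 - s)
            - (\<Sum>i\<le>Suc M. ((1 - s) gchoose i) * of_real (1 / N) ^ i))"
      using N by (simp only: norm_minus_cancel norm_mult) (simp add: norm_powr_real_powr)
    also have "\<dots> \<le> N powr (1 - Re s) * (C * (1 / N) ^ Suc (Suc M))"
      using N s by (intro mult_left_mono C(2)) auto
    also have "\<dots> = C * N powr ((1 - Re s) - real (Suc (Suc M)))"
      using N by (simp only: powr_diff powr_realpow) (simp add: power_one_over)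
    finally show "norm (zeta_step M n s) \<le> C * real (Suc n) powr (- Re s - real (Suc M))"
      unfolding N_def[symmetric] by (simp add: diff_diff_add add.commute)
  qed
qed

lemma summable_Suc_powr: "e < -1 \<Longrightarrow> summable (\<lambda>n. real (Suc n) powr e)"
  using summable_real_powr_iff[of e] summable_Suc_iff[of "\<lambda>n. real n powr e"] by simp

lemma holomorphic_zeta_step:
  obtains g where "g holomorphic_on {s. Re s > - real M}"
    "\<And>s. Re s > - real M \<Longrightarrow> (\<lambda>n. zeta_step M n s) sums g s"
proof -
  let ?S = "{s. Re s > - real M}"
  have S: "open ?S" by (rule open_halfspace_Re_gt)
  obtain g where g: "\<forall>s\<in>?S. (\<lambda>n. zeta_step M n s) sums g s \<and> g field_differentiable (at s)"
  proof (rule series_differentiable_comparison_complex[OF S])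
    fix n and s :: complex
    have "(\<lambda>s::complex. (1 - s) gchoose Suc j) field_differentiable at s" for j
      unfolding gbinomial_prod_rev
      by (intro holomorphic_on_imp_differentiable_at[of _ UNIV] holomorphic_intros) auto
    then show "zeta_step M n field_differentiable at s"
      unfolding zeta_step_def
      by (intro field_differentiable_add field_differentiable_diff field_differentiable_sum
            field_differentiable_mult
            holomorphic_on_imp_differentiable_at[of "\<lambda>s. _ powr _ s" UNIV] holomorphic_intros) auto
  next
    fix x assume x: "x \<in> ?S"
    define d where "d = (Re x + real M) / 2"
    have d: "d > 0" using x by (simp add: d_def)
    define A where "A = norm (1 - x) + d"
    have "A \<ge> 0" using d by (simp add: A_def)
    then obtain C where C: "C \<ge> 0"
      "\<And>s n. norm (1 - s) \<le> A \<Longrightarrow> norm (zeta_step M n s) \<le> C * real (Suc n) powr (- Re s - real (Suc M))"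
      by (rule zeta_step_bound[where M = M]) blast
    define e where "e = - (Re x - d) - real (Suc M)"
    have e: "e < -1" using d x by (simp add: e_def d_def field_simps)
    have "norm (zeta_step M n y) \<le> norm (complex_of_real (C * real (Suc n) powr e))"
      if "y \<in> ball x d" for y n
    proof -
      have xy: "norm (x - y) < d" using that by (simp add: dist_norm)
      have "norm (1 - y) \<le> A"
        using norm_triangle_ineq[of "1 - x" "x - y"] xy by (simp add: A_def)
      then have "norm (zeta_step M n y) \<le> C * real (Suc n) powr (- Re y - real (Suc M))" by (rule C)
      also have "\<dots> \<le> C * real (Suc n) powr e"
        using xy complex_Re_le_cmod[of "x - y"] C(1)
        by (intro mult_left_mono powr_mono) (auto simp: e_def)
      finally show ?thesis using C(1) by (simp add: norm_mult del: of_nat_Suc)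
    qed
    moreover have "summable (\<lambda>n. complex_of_real (C * real (Suc n) powr e))"
      by (rule summable_of_real, rule summable_mult, rule summable_Suc_powr[OF e])
    moreover have "range (\<lambda>n. complex_of_real (C * real (Suc n) powr e)) \<subseteq> \<real>\<^sub>\<ge>\<^sub>0"
      using C(1) by (auto simp: complex_nonneg_Reals_iff)
    ultimately show "\<exists>d (h :: nat \<Rightarrow> complex). 0 < d \<and> summable h \<and> range h \<subseteq> \<real>\<^sub>\<ge>\<^sub>0 \<and>
        (\<forall>\<^sub>F n in sequentially. \<forall>y\<in>ball x d \<inter> ?S. norm (zeta_step M n y) \<le> norm (h n))"
      using d by (intro exI[of _ d] exI[of _ "\<lambda>n. complex_of_real (C * real (Suc n) powr e)"]) auto
  qed auto
  then show ?thesis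
    using that[of g] S by (auto simp: holomorphic_on_open field_differentiable_def)
qed

lemma holomorphic_dirichlet_series:
  obtains z where "z holomorphic_on {s. Re s > 1}"
    "\<And>s. Re s > 1 \<Longrightarrow> (\<lambda>n. of_nat (Suc n) powr (- s)) sums z s"
proof -
  let ?S = "{s. Re s > 1}"
  have S: "open ?S" by (rule open_halfspace_Re_gt)
  obtain g where g: "\<forall>s\<in>?S. (\<lambda>n. of_nat (Suc n) powr (- s)) sums g s \<and> g field_differentiable (at s)"
  proof (rule series_differentiable_comparison_complex[OF S])
    show "(\<lambda>s. of_nat (Suc n) powr (- s)) field_differentiable at s" for n :: nat and s :: complex
      by (intro holomorphic_on_imp_differentiable_at[of _ UNIV] holomorphic_intros) auto
  next
    fix x assume x: "x \<in> ?S"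
    define d where "d = (Re x - 1) / 2"
    have d: "d > 0" using x by (simp add: d_def)
    define e where "e = - (Re x - d)"
    have e: "e < -1" using d x by (simp add: e_def d_def field_simps)
    have "norm (of_nat (Suc n) powr (- y)) \<le> norm (complex_of_real (real (Suc n) powr e))"
      if "y \<in> ball x d" for y n
    proof -
      have xy: "norm (x - y) < d" using that by (simp add: dist_norm)
      have "norm (of_nat (Suc n) powr (- y)) = real (Suc n) powr (- Re y)"
        by (subst norm_powr_real_powr) auto
      also have "\<dots> \<le> real (Suc n) powr e"
        using xy complex_Re_le_cmod[of "x - y"] by (intro powr_mono) (auto simp: e_def)
      finally show ?thesis by (simp del: of_nat_Suc)
    qed
    moreover have "summable (\<lambda>n. complex_of_real (real (Suc n) powr e))"
      by (rule summable_of_real, rule summable_Suc_powr[OF e])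
    moreover have "range (\<lambda>n. complex_of_real (real (Suc n) powr e)) \<subseteq> \<real>\<^sub>\<ge>\<^sub>0"
      by (auto simp: complex_nonneg_Reals_iff)
    ultimately show "\<exists>d (h :: nat \<Rightarrow> complex). 0 < d \<and> summable h \<and> range h \<subseteq> \<real>\<^sub>\<ge>\<^sub>0 \<and>
        (\<forall>\<^sub>F n in sequentially. \<forall>y\<in>ball x d \<inter> ?S. norm (of_nat (Suc n) powr (- y)) \<le> norm (h n))"
      using d by (intro exI[of _ d] exI[of _ "\<lambda>n. complex_of_real (real (Suc n) powr e)"]) auto
  qed auto
  then show ?thesis
    using that[of g] S by (auto simp: holomorphic_on_open field_differentiable_def)
qed

lemma zeta_telescope:
  assumes "Re s > 1"
  shows "(\<lambda>n. of_nat (Suc n) powr (1 - s) - of_nat (Suc (Suc n)) powr (1 - s)) sums (1 :: complex)"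
proof -
  have "(\<lambda>n. norm (of_nat (Suc n) powr (1 - s))) = (\<lambda>n. real (Suc n) powr (1 - Re s))"
    by (subst norm_powr_real_powr) auto
  moreover have "(\<lambda>n. real (Suc n) powr (1 - Re s)) \<longlonglongrightarrow> 0"
    using assms
    by (intro tendsto_neg_powr filterlim_compose[OF filterlim_real_sequentially filterlim_Suc]) auto
  ultimately have "(\<lambda>n. of_nat (Suc n) powr (1 - s)) \<longlonglongrightarrow> 0"
    by (simp only: tendsto_norm_zero_iff flip: tendsto_norm_zero_iff[of "\<lambda>n. of_nat (Suc n) powr (1 - s)"])
  from telescope_sums'[OF this] show ?thesis by simp
qed

lemma zeta_extension_aux:
  assumes z: "z holomorphic_on {s. Re s > 1}"
    "\<And>s. Re s > 1 \<Longrightarrow> (\<lambda>n. of_nat (Suc n) powr (- s)) sums z s"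
  shows "\<exists>F. F holomorphic_on {s. Re s > 1 - real M} \<and> (\<forall>s. Re s > 1 \<longrightarrow> F s = (s - 1) * z s)"
proof (induction M)
  case 0
  then show ?case using z(1)
    by (intro exI[of _ "\<lambda>s. (s - 1) * z s"]) (auto intro!: holomorphic_intros)
next
  case (Suc M)
  then obtain F where F: "F holomorphic_on {s. Re s > 1 - real M}"
    "\<And>s. Re s > 1 \<Longrightarrow> F s = (s - 1) * z s" by blast
  obtain g where g: "g holomorphic_on {s. Re s > - real M}"
    "\<And>s. Re s > - real M \<Longrightarrow> (\<lambda>n. zeta_step M n s) sums g s"
    using holomorphic_zeta_step by blast
  define G where "G = (\<lambda>s. 1 - (\<Sum>j<M. ((1 - s) gchoose Suc j) / of_nat (Suc (Suc j))
                          * F (s + of_nat (Suc j))) - g s)"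
  have "G holomorphic_on {s. Re s > - real M}"
    unfolding G_def gbinomial_prod_rev
    by (intro holomorphic_intros g(1)
          holomorphic_on_compose_gen[OF _ F(1), unfolded o_def]) auto
  moreover have "G s = (s - 1) * z s" if s: "Re s > 1" for s
  proof -
    have "(\<lambda>n. zeta_step M n s) sums
            (1 + (\<Sum>j\<le>M. ((1 - s) gchoose Suc j) * z (s + of_nat j)))"
      unfolding zeta_step_def
      using s by (intro sums_add zeta_telescope sums_sum sums_mult z(2)) auto
    then have "g s = 1 + (\<Sum>j\<le>M. ((1 - s) gchoose Suc j) * z (s + of_nat j))"
      using g(2)[of s] s by (auto intro: sums_unique2)
    also have "\<dots> = 1 + (1 - s) * z s + (\<Sum>j<M. ((1 - s) gchoose Suc (Suc j)) * z (s + of_nat (Suc j)))"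
      by (simp add: sum.atMost_shift add.assoc)
    also have "(\<Sum>j<M. ((1 - s) gchoose Suc (Suc j)) * z (s + of_nat (Suc j))) =
       (\<Sum>j<M. - (((1 - s) gchoose Suc j) / of_nat (Suc (Suc j)) * F (s + of_nat (Suc j))))"
    proof (rule sum.cong[OF refl])
      fix j
      have "((1 - s) gchoose Suc (Suc j)) =
              ((1 - s) gchoose Suc j) * (1 - s - of_nat (Suc j)) / of_nat (Suc (Suc j))"
        by (simp add: gbinomial_prod_rev divide_simps)
      moreover have "F (s + of_nat (Suc j)) = (s + of_nat (Suc j) - 1) * z (s + of_nat (Suc j))"
        using s by (intro F(2)) auto
      moreover have "1 - s - of_nat (Suc j) = - (s + of_nat (Suc j) - 1)" by simp
      ultimately show "((1 - s) gchoose Suc (Suc j)) * z (s + of_nat (Suc j)) =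
          - (((1 - s) gchoose Suc j) / of_nat (Suc (Suc j)) * F (s + of_nat (Suc j)))"
        by (simp only: mult_minus_right mult_minus_left minus_divide_left mult_ac
              times_divide_eq_left times_divide_eq_right)
    qed
    finally show ?thesis by (simp add: G_def sum_negf algebra_simps)
  qed
  moreover have "1 - real (Suc M) = - real M" by simp
  ultimately show ?case by metis
qed

lemma zeta_continuation_exists: "\<exists>f. zeta_continuation f"
proof -
  obtain z where z: "z holomorphic_on {s. Re s > 1}"
    "\<And>s. Re s > 1 \<Longrightarrow> (\<lambda>n. of_nat (Suc n) powr (- s)) sums z s"
    using holomorphic_dirichlet_series by blast
  obtain F where F: "\<And>M. F M holomorphic_on {s. Re s > 1 - real M}"
    "\<And>M s. Re s > 1 \<Longrightarrow> F M s = (s - 1) * z s"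
    using zeta_extension_aux[OF z] by metis
  have agree: "F M s = F M' s" if "M \<le> M'" "Re s > 1 - real M" for M M' s
  proof (rule analytic_continuation_open[where s = "{s. Re s > 1}" and s' = "{s. Re s > 1 - real M}"
        and f = "F M" and g = "F M'"])
    show "{s. Re s > 1} \<noteq> {}" by (auto intro: exI[of _ 2])
    show "connected {s. Re s > 1 - real M}"
      by (intro convex_connected convex_halfspace_Re_gt)
    show "F M' holomorphic_on {s. Re s > 1 - real M}"
      using that by (intro holomorphic_on_subset[OF F(1)[of M']]) auto
  qed (use F that in \<open>auto intro: open_halfspace_Re_gt\<close>)
  define H where "H = (\<lambda>s. F (nat \<lceil>2 - Re s\<rceil>) s)"
  have H: "H s = F M s" if s: "Re s > 1 - real M" for s M
  proof -
    let ?M = "nat \<lceil>2 - Re s\<rceil>"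
    have "Re s > 1 - real ?M" by linarith
    then show ?thesis using agree[of ?M M s] agree[of M ?M s] s
      unfolding H_def by (cases "M \<le> ?M") auto
  qed
  have holH: "H holomorphic_on UNIV"
  proof -
    have "H holomorphic_on (\<Union>M. {s. Re s > 1 - real M})"
    proof (rule holomorphic_on_UN_open)
      show "H holomorphic_on {s. Re s > 1 - real M}" for M
        using holomorphic_cong[THEN iffD1, OF refl _ F(1)[of M], of H] H by auto
    qed (rule open_halfspace_Re_gt)
    moreover have "(\<Union>M. {s. Re s > 1 - real M}) = UNIV"
    proof safe
      fix s
      obtain M where "real M > 1 - Re s" using reals_Archimedean2 by blast
      then show "s \<in> (\<Union>M. {s. Re s > 1 - real M})" by (auto intro!: exI[of _ M])
    qed auto
    ultimately show ?thesis by simp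
  qed
  define f where "f = (\<lambda>s. H s / (s - 1))"
  have "f holomorphic_on -{1}"
    unfolding f_def by (intro holomorphic_intros holomorphic_on_subset[OF holH]) auto
  moreover have "(\<lambda>n. 1 / of_nat (Suc n) powr s) sums f s" if "Re s > 1" for s
  proof -
    have "s \<noteq> 1" using that by auto
    then have "f s = z s" using H[of 0 s] F(2)[of s 0] that by (simp add: f_def)
    then show ?thesis using z(2)[OF that] by (simp add: powr_minus_divide)
  qed
  ultimately have "zeta_continuation f" by (auto simp: zeta_continuation_def f_def)
  then show ?thesis by (rule exI[of zeta_continuation f])
qed

lemma zeta_continuation_unique:
  assumes "zeta_continuation f" "zeta_continuation g"
  shows "f = g"
proof
  fix s
  show "f s = g s"
  proof (cases "s = 1")
    case True
    then show ?thesis using assms by (simp add: zeta_continuation_def)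
  next
    case False
    show ?thesis
    proof (rule analytic_continuation_open[where s = "{s. Re s > 1}" and s' = "-{1}"
          and f = f and g = g])
      show "{s. Re s > 1} \<noteq> {}" by (auto intro: exI[of _ 2])
      show "connected (-{1::complex})" by (intro connected_punctured_universe) auto
      show "f s = g s" if "s \<in> {s. Re s > 1}" for s
        using that assms unfolding zeta_continuation_def by (blast intro: sums_unique2)
    qed (use False assms in \<open>auto simp: zeta_continuation_def open_halfspace_Re_gt\<close>)
  qed
qed

lemma zeta_continuation_zeta: "zeta_continuation zeta"
proof -
  obtain f where f: "zeta_continuation f" using zeta_continuation_exists by (rule exE)
  show ?thesis unfolding zeta_def
    by (rule theI[of zeta_continuation f, OF f]) (rule zeta_continuation_unique[OF _ f])
qed

end

theory Submission
  imports Defs "HOL-Real_Asymp.Real_Asymp"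
begin

text \<open>
  Removing from a disc a thin slit running from every zero of \<open>zeta\<close> and from the pole \<open>1\<close> to
  infinity leaves a compact set \<open>M\<close> without zeros on which poles at the removed points can be
  pushed to infinity. Adding the removed points back as isolated points gives \<open>K\<close>. On \<open>M\<close> the
  polynomial \<open>H + w^2 Q\<close>, with \<open>w\<close> vanishing at the isolated points, is close to \<open>zeta\<close> once \<open>Q\<close>
  is close to \<open>(zeta - H) / w^2\<close>, and the values and derivatives at the isolated points are those
  of \<open>H\<close>, hence at our disposal.

  The Dirichlet polynomial is \<open>P o \<phi>\<close>, where \<open>\<phi>\<close> is a Dirichlet polynomial close to the identity
  that fixes the isolated points. Such a \<open>\<phi>\<close> exists because the exponential \<open>e^(h z)\<close>, as a function
  of \<open>-h\<close>, can be interpolated at the nodes \<open>log 1, ..., log k\<close>: the error is at most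
  \<open>(R (log k + 2))^k / k! * e^(R (log k + 1))\<close> for \<open>|z| \<le> R\<close>, which tends to \<open>0\<close>.
\<close>

subsection \<open>Dirichlet polynomials\<close>

text \<open>The step from \<open>k\<close> to \<open>k + 1\<close> nodes sends the error \<open>G\<close> to the solution \<open>T\<close> of
  \<open>T' + l k T = (l k - m) G\<close> with \<open>T 0 = 0\<close>; the factorial comes from integrating powers.\<close>

lemma exp_interpolation:
  fixes l :: "nat \<Rightarrow> real" and m L :: real
  assumes "inj l" "\<bar>m\<bar> \<le> L" "\<And>j. j < k \<Longrightarrow> \<bar>l j\<bar> \<le> L"
  shows "\<exists>c::nat \<Rightarrow> complex. \<forall>z. norm (exp (- of_real m * z) - (\<Sum>j<k. c j * exp (- of_real (l j) * z)))
           \<le> (\<Prod>j<k. \<bar>l j - m\<bar>) * norm z ^ k / fact k * exp (L * norm z)"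
  using assms(3)
proof (induction k)
  case 0
  have "norm (exp (- of_real m * z)) \<le> exp (L * norm z)" for z :: complex
  proof -
    have "norm (exp (- of_real m * z)) \<le> exp (norm (- of_real m * z))" by (rule norm_exp)
    also have "\<dots> \<le> exp (L * norm z)" using assms(2) by (simp add: norm_mult mult_right_mono)
    finally show ?thesis .
  qed
  then show ?case by simp
next
  case (Suc k)
  define A where "A = (\<Prod>j<k. \<bar>l j - m\<bar>)"
  have A0: "A \<ge> 0" by (simp add: A_def prod_nonneg)
  obtain c where c: "\<And>z::complex. norm (exp (- of_real m * z) - (\<Sum>j<k. c j * exp (- of_real (l j) * z)))
           \<le> A * norm z ^ k / fact k * exp (L * norm z)"
  proof -
    have "\<exists>c::nat \<Rightarrow> complex. \<forall>z. norm (exp (- of_real m * z) - (\<Sum>j<k. c j * exp (- of_real (l j) * z)))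
           \<le> A * norm z ^ k / fact k * exp (L * norm z)"
      unfolding A_def by (rule Suc.IH) (simp add: Suc.prems)
    then show ?thesis using that by blast
  qed
  define G where "G = (\<lambda>z. exp (- of_real m * z) - (\<Sum>j<k. c j * exp (- of_real (l j) * z)))"
  \<comment> \<open>These coefficients match the exponentials with exponents \<open>l j\<close> in
    \<open>T' + l k T = (l k - m) G\<close>; the coefficient at \<open>l k\<close> is then fixed by
    \<open>T 0 = 0\<close>.\<close>
  define d where "d = (\<lambda>j. c j * of_real (l k - m) / of_real (l k - l j))"
  define c' where "c' = (\<lambda>j. if j < k then d j else 1 - (\<Sum>j<k. d j))"
  define T where "T = (\<lambda>z. exp (- of_real m * z) - (\<Sum>j<Suc k. c' j * exp (- of_real (l j) * z)))"
  have T_eq: "T z = exp (- of_real m * z) - (\<Sum>j<k. d j * exp (- of_real (l j) * z))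
      - (1 - (\<Sum>j<k. d j)) * exp (- of_real (l k) * z)" for z
  proof -
    have "(\<Sum>j<k. c' j * exp (- of_real (l j) * z)) = (\<Sum>j<k. d j * exp (- of_real (l j) * z))"
      by (rule sum.cong) (auto simp: c'_def)
    moreover have "c' k = 1 - (\<Sum>j<k. d j)" by (simp add: c'_def)
    ultimately show ?thesis unfolding T_def sum.lessThan_Suc by (simp only: diff_diff_eq)
  qed
  have ne: "l k - l j \<noteq> 0" if "j < k" for j
    using injD[OF assms(1), of k j] that by auto
  have "norm (T z) \<le> (\<Prod>j<Suc k. \<bar>l j - m\<bar>) * norm z ^ Suc k / fact (Suc k) * exp (L * norm z)" for z
  proof -
    \<comment> \<open>\<open>T\<close> along the segment from 0 to \<open>z\<close>, times the
      integrating factor: the derivative involves \<open>G\<close> only, and \<open>f 0 = 0\<close>,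
      \<open>f 1 = T z\<close>.\<close>
    define f where "f = (\<lambda>t::real. exp (- of_real (l k) * (1 - of_real t) * z) * T (of_real t * z))"
    define f' where "f' = (\<lambda>t::real. z * exp (- of_real (l k) * (1 - of_real t) * z) * of_real (l k - m) * G (of_real t * z))"
    \<comment> \<open>The derivative of \<open>f\<close> is bounded by \<open>B * t ^ k\<close>;
      integration yields \<open>B / (k + 1)\<close>, which turns \<open>fact k\<close> into
      \<open>fact (Suc k)\<close>.\<close>
    define B where "B = norm z ^ Suc k * \<bar>l k - m\<bar> * A / fact k * exp (L * norm z)"
    have der: "(f has_vector_derivative f' t) (at t)" for t
    proof -
      define F where "F = (\<lambda>s. exp (- of_real (l k) * (1 - s) * z) * T (s * z))"
      define e where "e = exp (- of_real (l k) * (1 - of_real t) * z)"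
      define s where "s = complex_of_real t"
      have "(F has_field_derivative
          (of_real (l k) * z * e * T (s * z) +
           e * (- of_real m * z * exp (- of_real m * (s * z)) + (\<Sum>j<k. d j * of_real (l j) * z * exp (- of_real (l j) * (s * z)))
             + (1 - (\<Sum>j<k. d j)) * of_real (l k) * z * exp (- of_real (l k) * (s * z))))) (at s)"
        unfolding F_def T_eq e_def s_def
        by (auto intro!: derivative_eq_intros simp: sum_distrib_left sum_distrib_right sum_negf sum_subtractf algebra_simps)
      also have "(of_real (l k) * z * e * T (s * z) +
           e * (- of_real m * z * exp (- of_real m * (s * z)) + (\<Sum>j<k. d j * of_real (l j) * z * exp (- of_real (l j) * (s * z)))
             + (1 - (\<Sum>j<k. d j)) * of_real (l k) * z * exp (- of_real (l k) * (s * z))))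
          = z * e * (of_real (l k - m) * exp (- of_real m * (s * z))
             - (\<Sum>j<k. d j * of_real (l k - l j) * exp (- of_real (l j) * (s * z))))"
        unfolding T_eq
        by (simp add: algebra_simps sum_subtractf sum_distrib_left sum_distrib_right)
      also have "(\<Sum>j<k. d j * of_real (l k - l j) * exp (- of_real (l j) * (s * z)))
          = (\<Sum>j<k. c j * of_real (l k - m) * exp (- of_real (l j) * (s * z)))"
      proof (rule sum.cong[OF refl])
        fix j assume "j \<in> {..<k}"
        then have "complex_of_real (l k - l j) \<noteq> 0" using ne by (simp del: of_real_diff)
        then have "d j * of_real (l k - l j) = c j * of_real (l k - m)" unfolding d_def by simp
        then show "d j * of_real (l k - l j) * exp (- of_real (l j) * (s * z)) = c j * of_real (l k - m) * exp (- of_real (l j) * (s * z))"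
          by simp
      qed
      also have "\<dots> = of_real (l k - m) * (\<Sum>j<k. c j * exp (- of_real (l j) * (s * z)))"
        unfolding sum_distrib_left by (simp only: mult_ac)
      also have "z * e * (of_real (l k - m) * exp (- of_real m * (s * z)) - \<dots>) = f' t"
        unfolding f'_def e_def G_def s_def
        by (simp only: mult.assoc mult.commute mult.left_commute right_diff_distrib[symmetric])
      finally have "(F has_field_derivative f' t) (at (of_real t))" unfolding s_def .
      from has_vector_derivative_real_field[OF this]
      show ?thesis unfolding f_def F_def o_def by simp
    qed
    have "norm (f 1 - f 0) \<le> B * 1 ^ Suc k / real (Suc k) - B * 0 ^ Suc k / real (Suc k)"
    proof (rule differentiable_bound_general[where f' = f' and \<phi>' = "\<lambda>t. B * t ^ k"])
      show "continuous_on {0..1} f"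
        using der by (meson continuous_at_imp_continuous_on has_vector_derivative_continuous)
      show "continuous_on {0..1} (\<lambda>t. B * t ^ Suc k / real (Suc k))" by (intro continuous_intros) auto
      show "((\<lambda>t. B * t ^ Suc k / real (Suc k)) has_vector_derivative B * t ^ k) (at t)" for t
        unfolding has_real_derivative_iff_has_vector_derivative[symmetric]
        by (auto intro!: derivative_eq_intros simp del: power_Suc of_nat_Suc)
      fix t :: real assume t: "0 < t" "t < 1"
      have "norm (exp (- of_real (l k) * (1 - of_real t) * z)) \<le> exp (norm (- of_real (l k) * (1 - of_real t) * z))"
        by (rule norm_exp)
      also have "norm (- of_real (l k) * (1 - of_real t) * z) = \<bar>l k\<bar> * (1 - t) * norm z"
      proof -
        have "norm (1 - complex_of_real t) = \<bar>1 - t\<bar>" by (metis norm_of_real of_real_1 of_real_diff)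
        then show ?thesis using t by (simp only: norm_mult norm_minus_cancel norm_of_real)
      qed
      also have "\<dots> \<le> L * (1 - t) * norm z" using t Suc.prems[of k] by (intro mult_right_mono) auto
      finally have 1: "norm (exp (- of_real (l k) * (1 - of_real t) * z)) \<le> exp (L * (1 - t) * norm z)" by simp
      have 2: "norm (G (of_real t * z)) \<le> A * (t * norm z) ^ k / fact k * exp (L * (t * norm z))"
        using c[of "of_real t * z"] t unfolding G_def by (simp add: norm_mult)
      have "norm (f' t) \<le> norm z * exp (L * (1 - t) * norm z) * \<bar>l k - m\<bar> * (A * (t * norm z) ^ k / fact k * exp (L * (t * norm z)))"
        unfolding f'_def norm_mult norm_of_real using 1 2 A0 by (intro mult_mono) (auto intro!: mult_nonneg_nonneg)
      also have "\<dots> = norm z ^ Suc k * \<bar>l k - m\<bar> * A / fact k * (exp (L * (1 - t) * norm z) * exp (L * (t * norm z))) * t ^ k"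
        by (simp add: power_mult_distrib)
      also have "exp (L * (1 - t) * norm z) * exp (L * (t * norm z)) = exp (L * norm z)"
        unfolding exp_add[symmetric] by (simp add: algebra_simps)
      finally show "norm (f' t) \<le> B * t ^ k" unfolding B_def .
    qed (use der in auto)
    moreover have "f 0 = 0" unfolding f_def T_eq by simp
    moreover have "f 1 = T z" unfolding f_def by simp
    ultimately have "norm (T z) \<le> B / real (Suc k)" by simp
    also have "\<dots> = (\<Prod>j<Suc k. \<bar>l j - m\<bar>) * norm z ^ Suc k / fact (Suc k) * exp (L * norm z)"
      unfolding B_def A_def by (simp add: mult_ac)
    finally show ?thesis .
  qed
  then show ?case unfolding T_def by blast
qed

text \<open>\<open>k^k / k!\<close> is one term of the exponential series at \<open>k\<close>, hence
  at most \<open>exp k\<close>.\<close>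

lemma power_over_fact_le:
  fixes x :: real
  assumes x: "0 \<le> x" "0 < k"
  shows "x ^ k / fact k \<le> (exp 1 * x / real k) ^ k"
proof -
  have "real k ^ k / fact k \<le> exp (real k)"
  proof -
    have "(\<Sum>i\<in>{k}. inverse (fact i) * real k ^ i) \<le> (\<Sum>i. inverse (fact i) * real k ^ i)"
      by (rule sum_le_suminf) (use summable_exp[of "real k"] in auto)
    then show ?thesis by (simp add: exp_def scaleR_conv_of_real divide_inverse mult.commute)
  qed
  then have "x ^ k * (real k ^ k / fact k) / real k ^ k \<le> x ^ k * exp (real k) / real k ^ k"
    using x by (intro divide_right_mono mult_left_mono) auto
  moreover have "x ^ k * (real k ^ k / fact k) / real k ^ k = x ^ k / fact k" using x by simp
  moreover have "x ^ k * exp (real k) / real k ^ k = (exp 1 * x / real k) ^ k"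
    using exp_of_nat_mult[of k "1::real"] by (simp add: power_divide power_mult_distrib)
  ultimately show ?thesis by simp
qed

text \<open>Once \<open>exp 1 * R * (ln k + 2) / k\<close> is below 1/2, the first factor is at most
  \<open>(1/2)^k\<close>, while the exponential factor grows only like a power of
  \<open>k\<close>.\<close>

lemma interpolation_error_tendsto_0:
  fixes R :: real
  assumes "R > 0"
  shows "(\<lambda>k. (R * (ln (real k) + 2)) ^ k / fact k * exp ((ln (real k) + 1) * R)) \<longlonglongrightarrow> 0"
proof (rule tendsto_sandwich[where f = "\<lambda>_. 0"])
  show "(\<lambda>k. (1/2) ^ k * exp ((ln (real k) + 1) * R)) \<longlonglongrightarrow> 0"
    using assms by real_asymp
  have "(\<lambda>k. exp 1 * (R * (ln (real k) + 2)) / real k) \<longlonglongrightarrow> 0" by real_asymp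
  then have "\<forall>\<^sub>F k in sequentially. exp 1 * (R * (ln (real k) + 2)) / real k < 1/2"
    by (rule order_tendstoD) simp
  then show "\<forall>\<^sub>F k in sequentially. (R * (ln (real k) + 2)) ^ k / fact k * exp ((ln (real k) + 1) * R)
      \<le> (1/2) ^ k * exp ((ln (real k) + 1) * R)"
    using eventually_gt_at_top[of 0]
  proof eventually_elim
    case (elim k)
    have "ln (real k) \<ge> 0" using elim by simp
    then have nn: "0 \<le> R * (ln (real k) + 2)" using assms by simp
    then have "(R * (ln (real k) + 2)) ^ k / fact k \<le> (exp 1 * (R * (ln (real k) + 2)) / real k) ^ k"
      using elim by (intro power_over_fact_le) auto
    also have "\<dots> \<le> (1/2) ^ k" using elim nn by (intro power_mono) auto
    finally show ?case by (intro mult_right_mono) auto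
  qed
  show "\<forall>\<^sub>F k in sequentially. 0 \<le> (R * (ln (real k) + 2)) ^ k / fact k * exp ((ln (real k) + 1) * R)"
    using eventually_gt_at_top[of 0] by eventually_elim (use assms in \<open>auto intro!: mult_nonneg_nonneg\<close>)
qed simp

text \<open>With \<open>m = - h\<close> and the nodes \<open>ln 1, ..., ln k\<close>, the
  exponentials \<open>exp (- z * ln n)\<close> of the interpolation are the terms
  \<open>n^(-z)\<close>.\<close>

lemma dirichlet_exp_approx:
  fixes h R :: real
  assumes h: "0 < h" "h \<le> 1" and R: "R > 0" and e: "e > 0"
  shows "\<exists>D. dirichlet_polynomial D \<and> (\<forall>z. norm z \<le> R \<longrightarrow> norm (exp (of_real h * z) - D z) < e)"
proof -
  from order_tendstoD(2)[OF interpolation_error_tendsto_0[OF R] e]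
  obtain k where k: "k \<ge> 1" "(R * (ln (real k) + 2)) ^ k / fact k * exp ((ln (real k) + 1) * R) < e"
    by (metis (mono_tags, lifting) eventually_sequentially nle_le)
  \<comment> \<open>Bounds the nodes as well as \<open>h \<le> 1\<close>, as the exponential factor
    of the interpolation error requires.\<close>
  define L where "L = ln (real k) + 1"
  have lk: "ln (real k) \<ge> 0" using k by simp
  define l where "l = (\<lambda>j. ln (real (Suc j)))"
  have l: "0 \<le> l j" "l j \<le> ln (real k)" if "j < k" for j
    unfolding l_def using that by (auto simp del: of_nat_Suc)
  have "inj l" by (auto simp: inj_def l_def)
  moreover have "\<bar>- h\<bar> \<le> L" using h lk by (simp add: L_def)
  moreover have "\<bar>l j\<bar> \<le> L" if "j < k" for j using l[OF that] by (simp add: L_def)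
  ultimately obtain c :: "nat \<Rightarrow> complex" where c: "\<And>z. norm (exp (- of_real (- h) * z) - (\<Sum>j<k. c j * exp (- of_real (l j) * z)))
           \<le> (\<Prod>j<k. \<bar>l j - (- h)\<bar>) * norm z ^ k / fact k * exp (L * norm z)"
    using exp_interpolation[of l "- h" L k] by blast
  \<comment> \<open>The node \<open>l j\<close> is the logarithm of \<open>j + 1\<close>, hence the
    shift in \<open>c (n - 1)\<close>.\<close>
  define D where "D = (\<lambda>z. \<Sum>n=1..k. c (n - 1) / of_nat n powr z)"
  have D: "D z = (\<Sum>j<k. c j * exp (- of_real (l j) * z))" for z
  proof -
    have "D z = (\<Sum>j<k. c j / of_nat (Suc j) powr z)"
      unfolding D_def by (rule sum.reindex_bij_witness[of _ Suc "\<lambda>n. n - 1"]) auto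
    also have "\<dots> = (\<Sum>j<k. c j * exp (- of_real (l j) * z))"
    proof (rule sum.cong[OF refl])
      fix j
      have "(of_nat (Suc j) :: complex) powr z = exp (z * of_real (l j))"
        unfolding powr_def l_def
        by (simp add: Ln_of_nat del: of_nat_Suc)
      then show "c j / of_nat (Suc j) powr z = c j * exp (- of_real (l j) * z)"
        by (simp add: exp_minus divide_inverse mult.commute)
    qed
    finally show ?thesis .
  qed
  show ?thesis
  proof (intro exI[of _ D] conjI allI impI)
    show "dirichlet_polynomial D" unfolding dirichlet_polynomial_def D_def
      by (intro exI[of _ k] exI[of _ "\<lambda>n. c (n - 1)"]) (rule refl)
    fix z :: complex assume z: "norm z \<le> R"
    have "(\<Prod>j<k. \<bar>l j - (- h)\<bar>) \<le> (\<Prod>j<k. ln (real k) + 2)"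
      using l h by (intro prod_mono) (smt (verit) lessThan_iff)
    then have "norm (exp (- of_real (- h) * z) - D z) \<le> (ln (real k) + 2) ^ k * R ^ k / fact k * exp (L * R)"
      unfolding D using z lk R
      by (intro order_trans[OF c] mult_mono divide_right_mono power_mono)
         (auto intro!: mult_nonneg_nonneg prod_nonneg mult_left_mono simp: L_def)
    also have "\<dots> < e" using k(2) by (simp add: L_def power_mult_distrib mult.commute)
    finally show "norm (exp (of_real h * z) - D z) < e" by simp
  qed
qed

section \<open>Closure properties of Dirichlet polynomials\<close>

lemma dirichlet_polynomial_term: "k \<ge> 1 \<Longrightarrow> dirichlet_polynomial (\<lambda>z. c / of_nat k powr z)"
  unfolding dirichlet_polynomial_def
proof (intro exI[of _ k] exI[of _ "\<lambda>n. if n = k then c else 0"] ext)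
  fix z assume "k \<ge> 1"
  then show "c / of_nat k powr z = (\<Sum>n=1..k. (if n = k then c else 0) / of_nat n powr z)"
    by (subst sum.remove[of _ k]) (auto intro!: sum.neutral)
qed

lemma dirichlet_polynomial_const: "dirichlet_polynomial (\<lambda>z. c)"
  using dirichlet_polynomial_term[of 1 c] by simp

lemma dirichlet_polynomial_add:
  assumes "dirichlet_polynomial f" "dirichlet_polynomial g"
  shows "dirichlet_polynomial (\<lambda>z. f z + g z)"
proof -
  obtain m a where f: "f = (\<lambda>z. \<Sum>n=1..m. a n / of_nat n powr z)"
    using assms(1) unfolding dirichlet_polynomial_def by blast
  obtain m' a' where g: "g = (\<lambda>z. \<Sum>n=1..m'. a' n / of_nat n powr z)"
    using assms(2) unfolding dirichlet_polynomial_def by blast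
  \<comment> \<open>Padding with zero coefficients brings both sums to a common length.\<close>
  have pad: "(\<Sum>n=1..k. b n / of_nat n powr z) = (\<Sum>n=1..max m m'. (if n \<le> k then b n else 0) / of_nat n powr z)"
    if "k \<le> max m m'" for k z and b :: "nat \<Rightarrow> complex"
    by (rule sum.mono_neutral_cong_left) (use that in auto)
  have "(\<lambda>z. f z + g z) = (\<lambda>z. \<Sum>n=1..max m m'. ((if n \<le> m then a n else 0) + (if n \<le> m' then a' n else 0)) / of_nat n powr z)"
    unfolding f g by (subst (1 2) pad) (auto simp: add_divide_distrib sum.distrib)
  then show ?thesis unfolding dirichlet_polynomial_def
    by (intro exI[of _ "max m m'"] exI[of _ "\<lambda>n. (if n \<le> m then a n else 0) + (if n \<le> m' then a' n else 0)"])
qed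

lemma dirichlet_polynomial_sum:
  "(\<And>i. i \<in> I \<Longrightarrow> dirichlet_polynomial (f i)) \<Longrightarrow> dirichlet_polynomial (\<lambda>z. \<Sum>i\<in>I. f i z)"
  by (induction I rule: infinite_finite_induct)
     (auto intro: dirichlet_polynomial_const dirichlet_polynomial_add)

text \<open>The identity \<open>n^(-z) k^(-z) = (n k)^(-z)\<close> makes a product a double sum of
  single terms.\<close>

lemma dirichlet_polynomial_mult:
  assumes "dirichlet_polynomial f" "dirichlet_polynomial g"
  shows "dirichlet_polynomial (\<lambda>z. f z * g z)"
proof -
  obtain m a where f: "f = (\<lambda>z. \<Sum>n=1..m. a n / of_nat n powr z)"
    using assms(1) unfolding dirichlet_polynomial_def by blast
  obtain m' a' where g: "g = (\<lambda>z. \<Sum>n=1..m'. a' n / of_nat n powr z)"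
    using assms(2) unfolding dirichlet_polynomial_def by blast
  have "of_nat n powr z * of_nat k powr z = (of_nat (n * k) :: complex) powr z" for n k :: nat and z
    using powr_times_real[of "of_nat n" "of_nat k" z] by simp
  then have "(\<lambda>z. f z * g z) = (\<lambda>z. \<Sum>n=1..m. \<Sum>k=1..m'. (a n * a' k) / of_nat (n * k) powr z)"
    unfolding f g sum_product by (simp del: of_nat_mult)
  moreover have "dirichlet_polynomial (\<lambda>z. \<Sum>n=1..m. \<Sum>k=1..m'. (a n * a' k) / of_nat (n * k) powr z)"
    by (intro dirichlet_polynomial_sum dirichlet_polynomial_term) auto
  ultimately show ?thesis by simp
qed

lemma dirichlet_polynomial_poly:
  assumes "dirichlet_polynomial f"
  shows "dirichlet_polynomial (\<lambda>z. poly p (f z))"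
  by (induction p)
     (auto intro!: dirichlet_polynomial_const dirichlet_polynomial_add dirichlet_polynomial_mult assms)

text \<open>The logarithms of the integers \<open>n \<ge> 1\<close> are real, so this reflection
  only conjugates the coefficients. Averaging with it later makes a Dirichlet polynomial real on the
  real axis.\<close>

lemma dirichlet_polynomial_cnj:
  assumes "dirichlet_polynomial f"
  shows "dirichlet_polynomial (\<lambda>z. cnj (f (cnj z)))"
proof -
  obtain m a where f: "f = (\<lambda>z. \<Sum>n=1..m. a n / of_nat n powr z)"
    using assms unfolding dirichlet_polynomial_def by blast
  have "cnj (of_nat n powr cnj z) = of_nat n powr z" if "n \<ge> 1" for n :: nat and z :: complex
    using that by (simp add: powr_def Ln_of_nat exp_cnj)
  then have "(\<lambda>z. cnj (f (cnj z))) = (\<lambda>z. \<Sum>n=1..m. cnj (a n) / of_nat n powr z)"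
    unfolding f by simp
  then show ?thesis unfolding dirichlet_polynomial_def
    by (intro exI[of _ m] exI[of _ "\<lambda>n. cnj (a n)"])
qed

lemma holomorphic_dirichlet_polynomial:
  assumes "dirichlet_polynomial f"
  shows "f holomorphic_on A"
proof -
  obtain m a where f: "f = (\<lambda>z. \<Sum>n=1..m. a n / of_nat n powr z)"
    using assms unfolding dirichlet_polynomial_def by blast
  show ?thesis unfolding f by (intro holomorphic_intros) auto
qed

section \<open>Dirichlet polynomials close to the identity\<close>

text \<open>The quotient \<open>(exp (h z) - 1) / h\<close> tends to \<open>z\<close> as
  \<open>h\<close> tends to 0; replacing the exponential by a Dirichlet polynomial with error below
  \<open>h * (e / 2)\<close> costs \<open>e / 2\<close> after division by \<open>h\<close>.\<close>

lemma dirichlet_id_approx: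
  fixes e R :: real
  assumes e: "e > 0" and R: "R > 0"
  shows "\<exists>D. dirichlet_polynomial D \<and> (\<forall>z. norm z \<le> R \<longrightarrow> norm (D z - z) < e)"
proof -
  \<comment> \<open>The Taylor error is at most \<open>h * (exp R * (h * R^2))\<close>, so this
    choice leaves less than \<open>e / 2\<close> of it after division by \<open>h\<close>; the bound
    1 on \<open>h\<close> gives \<open>exp (h * R) \<le> exp R\<close>.\<close>
  define h where "h = min 1 (e / (4 * exp R * R\<^sup>2))"
  have h: "0 < h" "h \<le> 1" using e R by (auto simp: h_def)
  have "h * (exp R * R\<^sup>2) \<le> e / (4 * exp R * R\<^sup>2) * (exp R * R\<^sup>2)"
    by (intro mult_right_mono) (auto simp: h_def)
  also have "\<dots> = e / 4" using R by simp
  finally have he: "exp R * (h * R\<^sup>2) < e / 2" using e by (simp add: mult_ac)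
  obtain D where D: "dirichlet_polynomial D"
    "\<And>z. norm z \<le> R \<Longrightarrow> norm (exp (of_real h * z) - D z) < h * (e / 2)"
    using dirichlet_exp_approx[OF h R, of "h * (e / 2)"] e h by auto
  show ?thesis
  proof (intro exI[of _ "\<lambda>z. of_real (1 / h) * (D z + (-1))"] conjI allI impI)
    show "dirichlet_polynomial (\<lambda>z. of_real (1 / h) * (D z + (-1)))"
      by (intro dirichlet_polynomial_mult dirichlet_polynomial_const dirichlet_polynomial_add D)
    fix z :: complex assume z: "norm z \<le> R"
    have "norm (exp (of_real h * z) - (\<Sum>i\<le>1. (of_real h * z) ^ i / fact i)) \<le>
          exp (norm (of_real h * z)) * norm (of_real h * z) ^ Suc 1 / fact 1"
      by (rule Taylor_exp_field)
    then have "norm (exp (of_real h * z) - (1 + of_real h * z)) \<le> exp (h * norm z) * (h * norm z)\<^sup>2"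
      using h by (simp add: norm_mult power2_eq_square)
    also have "\<dots> \<le> exp R * (h * R)\<^sup>2"
      using h z R by (intro mult_mono power_mono) (auto intro: mult_le_one order_trans[OF mult_right_mono[of h 1]])
    also have "\<dots> = h * (exp R * (h * R\<^sup>2))" by (simp add: power2_eq_square)
    also have "\<dots> < h * (e / 2)" using he h by simp
    finally have "norm (exp (of_real h * z) - (1 + of_real h * z)) < h * (e / 2)" .
    then have "norm ((exp (of_real h * z) - (1 + of_real h * z)) - (exp (of_real h * z) - D z)) < h * (e / 2) + h * (e / 2)"
      using D(2)[OF z] by (rule le_less_trans[OF norm_triangle_ineq4 add_strict_mono])
    then have *: "norm (D z - 1 - of_real h * z) < h * e" by (simp add: algebra_simps)
    have "of_real (1 / h) * (D z + (-1)) - z = of_real (1 / h) * (D z - 1 - of_real h * z)"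
      using h by (simp add: field_simps)
    then have "norm (of_real (1 / h) * (D z + (-1)) - z) = norm (D z - 1 - of_real h * z) / h"
      using h by (simp only: norm_mult norm_of_real) simp
    also have "\<dots> < e" using * h by (simp add: field_simps)
    finally show "norm (of_real (1 / h) * (D z + (-1)) - z) < e" .
  qed
qed

text \<open>Newton interpolation: a multiple of the product over the earlier nodes adjusts the value
  at the new node without changing the others.\<close>

lemma poly_interpolation:
  fixes t :: "'a \<Rightarrow> 'b :: field"
  assumes "finite E" "inj_on x E"
  shows "\<exists>p. \<forall>e\<in>E. poly p (x e) = t e"
  using assms
proof (induction E)
  case (insert a E)
  then obtain p where p: "\<forall>e\<in>E. poly p (x e) = t e" by auto
  define w where "w = (\<Prod>e\<in>E. [:- x e, 1:])"
  have "poly w (x a) \<noteq> 0" using insert by (auto simp: w_def poly_prod inj_on_def)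
  moreover have "poly w (x e) = 0" if "e \<in> E" for e
    using that insert.hyps by (auto simp: w_def poly_prod)
  ultimately show ?case using p insert.hyps
    by (intro exI[of _ "p + smult ((t a - poly p (x a)) / poly w (x a)) w"]) auto
qed simp

text \<open>The basis functions \<open>b x\<close> come from a fixed Dirichlet polynomial
  \<open>F\<close>, so their bound \<open>B\<close> is known before the closer approximation
  \<open>G\<close> is chosen, and correcting \<open>G\<close> on \<open>E\<close> costs little.
  Averaging with the reflection supplies the symmetry.\<close>

lemma dirichlet_interpolating_approx:
  fixes e R :: real
  assumes E: "finite E" "E \<subseteq> cball 0 R" "cnj ` E \<subseteq> E" and e: "e > 0" and R: "R > 0"
  obtains D where "dirichlet_polynomial D" "\<And>z. norm z \<le> R \<Longrightarrow> norm (D z - z) < e"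
    "\<And>x. x \<in> E \<Longrightarrow> D x = x" "\<And>z. D (cnj z) = cnj (D z)"
proof -
  \<comment> \<open>\<open>s\<close> separates the points of \<open>E\<close>; the 1 inserted into
    the minimum covers an \<open>E\<close> with fewer than two points.\<close>
  obtain s where s: "s > 0" "\<And>x y. x \<in> E \<Longrightarrow> y \<in> E \<Longrightarrow> x \<noteq> y \<Longrightarrow> s \<le> dist x y"
  proof -
    let ?S = "(\<lambda>(x,y). dist x y) ` (E \<times> E - Id)"
    have fin: "finite ?S" using E(1) by auto
    have "Min (insert 1 ?S) > 0" using fin by (subst Min_gr_iff) auto
    moreover have "Min (insert 1 ?S) \<le> dist x y" if "x \<in> E" "y \<in> E" "x \<noteq> y" for x y
      using that fin by (intro Min_le) (auto intro!: rev_image_eqI[of "(x, y)"])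
    ultimately show ?thesis using that by blast
  qed
  obtain F where F: "dirichlet_polynomial F" "\<And>z. norm z \<le> R \<Longrightarrow> norm (F z - z) < s / 2"
    using dirichlet_id_approx[of "s / 2" R] s R by auto
  \<comment> \<open>A map within \<open>s / 2\<close> of the identity cannot identify two points at
    distance at least \<open>s\<close>.\<close>
  have "inj_on F E"
  proof (rule inj_onI, rule ccontr)
    fix x y assume xy: "x \<in> E" "y \<in> E" "F x = F y" "x \<noteq> y"
    have "norm (F x - x) < s / 2" "norm (F y - y) < s / 2" using F(2)[of x] F(2)[of y] E(2) xy(1,2) by auto
    then have "norm ((F y - y) - (F x - x)) < s" by (intro le_less_trans[OF norm_triangle_ineq4]) simp
    then show False using s(2)[of x y] xy by (simp add: dist_norm)
  qed
  then have "\<exists>p. \<forall>y\<in>E. poly p (F y) = (if y = x then 1 else 0)" for x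
    by (rule poly_interpolation[OF E(1)])
  then obtain p where p: "\<And>x y. y \<in> E \<Longrightarrow> poly (p x) (F y) = (if y = x then 1 else 0)" by metis
  \<comment> \<open>Lagrange basis in the variable \<open>F z\<close>: \<open>b x\<close> is 1 at
    \<open>x\<close> and 0 at the other points of \<open>E\<close>.\<close>
  define b where "b = (\<lambda>x z. poly (p x) (F z))"
  have "compact ((\<lambda>z. \<Sum>x\<in>E. norm (b x z)) ` cball 0 R)"
    unfolding b_def
    by (intro compact_continuous_image continuous_intros holomorphic_on_imp_continuous_on
          holomorphic_dirichlet_polynomial dirichlet_polynomial_poly F(1)) auto
  then have "bounded ((\<lambda>z. \<Sum>x\<in>E. norm (b x z)) ` cball 0 R)" by (rule compact_imp_bounded)
  then obtain B where B': "\<forall>y\<in>(\<lambda>z. \<Sum>x\<in>E. norm (b x z)) ` cball 0 R. norm y \<le> B"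
    unfolding bounded_iff by blast
  have B: "(\<Sum>x\<in>E. norm (b x z)) \<le> B" if "norm z \<le> R" for z
  proof -
    have "norm (\<Sum>x\<in>E. norm (b x z)) \<le> B" using B' that by simp
    then show ?thesis by simp
  qed
  have B0: "B \<ge> 0" using R by (intro order_trans[OF sum_nonneg B[of 0]]) auto
  \<comment> \<open>The error of \<open>G\<close> and the correction on \<open>E\<close> add up to
    less than \<open>d + d * B = e\<close>.\<close>
  define d where "d = e / (1 + B)"
  have d: "d > 0" "d * (1 + B) = e" using e B0 by (auto simp: d_def)
  obtain G where G: "dirichlet_polynomial G" "\<And>z. norm z \<le> R \<Longrightarrow> norm (G z - z) < d"
    using dirichlet_id_approx[OF d(1) R] by auto
  define H where "H = (\<lambda>z. G z + (\<Sum>x\<in>E. (x - G x) * b x z))"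
  have H: "dirichlet_polynomial H" unfolding H_def b_def
    by (intro dirichlet_polynomial_sum dirichlet_polynomial_mult dirichlet_polynomial_const
        dirichlet_polynomial_add dirichlet_polynomial_poly F G)
  have He: "norm (H z - z) < e" if z: "norm z \<le> R" for z
  proof -
    have "norm (\<Sum>x\<in>E. (x - G x) * b x z) \<le> (\<Sum>x\<in>E. d * norm (b x z))"
    proof (rule sum_norm_le)
      fix x assume "x \<in> E"
      then have "norm (x - G x) \<le> d" using G(2)[of x] E(2) by (auto simp: norm_minus_commute)
      then show "norm ((x - G x) * b x z) \<le> d * norm (b x z)" by (simp add: norm_mult mult_right_mono)
    qed
    also have "\<dots> \<le> d * B" using B[OF z] d(1) by (simp flip: sum_distrib_left)
    finally have "norm ((G z - z) + (\<Sum>x\<in>E. (x - G x) * b x z)) < d + d * B"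
      using G(2)[OF z] by (intro le_less_trans[OF norm_triangle_ineq]) simp
    then show ?thesis using d(2) by (simp add: H_def algebra_simps)
  qed
  have HE: "H y = y" if "y \<in> E" for y
  proof -
    have "(\<Sum>x\<in>E. (x - G x) * b x y) = (\<Sum>x\<in>E. if x = y then y - G y else 0)"
      using that by (intro sum.cong) (auto simp: b_def p)
    then show ?thesis using that E(1) by (simp add: H_def)
  qed
  define D where "D = (\<lambda>z. (1 / 2) * (H z + cnj (H (cnj z))))"
  show ?thesis
  proof (rule that[of D])
    show "dirichlet_polynomial D" unfolding D_def
      by (intro dirichlet_polynomial_mult dirichlet_polynomial_const
        dirichlet_polynomial_add dirichlet_polynomial_cnj H)
    show "norm (D z - z) < e" if "norm z \<le> R" for z
    proof -
      have "norm (cnj (H (cnj z) - cnj z)) < e" using He[of "cnj z"] that by (simp only: complex_mod_cnj)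
      then have "norm ((H z - z) + cnj (H (cnj z) - cnj z)) < e + e"
        using He[OF that] by (intro le_less_trans[OF norm_triangle_ineq]) simp
      moreover have "D z - z = (1/2) * ((H z - z) + cnj (H (cnj z) - cnj z))"
        by (simp add: D_def algebra_simps)
      ultimately show ?thesis by (simp only: norm_mult) simp
    qed
    show "D x = x" if "x \<in> E" for x
    proof -
      have "cnj x \<in> E" using that E(3) by auto
      then show ?thesis using HE[of x] HE[of "cnj x"] that by (simp add: D_def)
    qed
    show "D (cnj z) = cnj (D z)" for z by (simp add: D_def add.commute)
  qed
qed

subsection \<open>Uniform approximation by polynomials\<close>

definition polynomially_approximable :: "complex set \<Rightarrow> (complex \<Rightarrow> complex) \<Rightarrow> bool" where
  "polynomially_approximable M f \<longleftrightarrow> (\<forall>e>0. \<exists>p. \<forall>z\<in>M. norm (poly p z - f z) < e)"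

lemma polynomially_approximable_poly: "polynomially_approximable M (poly p)"
  unfolding polynomially_approximable_def by (intro allI impI exI[of _ p]) simp

lemma polynomially_approximable_const: "polynomially_approximable M (\<lambda>_. c)"
  unfolding polynomially_approximable_def by (intro allI impI exI[of _ "[:c:]"]) simp

lemma polynomially_approximable_cong:
  "(\<And>z. z \<in> M \<Longrightarrow> f z = g z) \<Longrightarrow> polynomially_approximable M f = polynomially_approximable M g"
  unfolding polynomially_approximable_def by simp

lemma polynomially_approximable_limit:
  assumes "\<And>e. e > 0 \<Longrightarrow> \<exists>g. polynomially_approximable M g \<and> (\<forall>z\<in>M. norm (g z - f z) < e)"
  shows "polynomially_approximable M f"
  unfolding polynomially_approximable_def
proof (intro allI impI)
  fix e :: real assume e: "e > 0"
  obtain g where g: "polynomially_approximable M g" "\<forall>z\<in>M. norm (g z - f z) < e / 2"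
    using assms[of "e / 2"] e by auto
  obtain p where p: "\<forall>z\<in>M. norm (poly p z - g z) < e / 2"
    using g(1) e unfolding polynomially_approximable_def by (meson half_gt_zero)
  have "norm (poly p z - f z) < e" if "z \<in> M" for z
    using norm_triangle_ineq[of "poly p z - g z" "g z - f z"] p g(2) that by fastforce
  then show "\<exists>p. \<forall>z\<in>M. norm (poly p z - f z) < e" by blast
qed

lemma polynomially_approximable_add:
  assumes "polynomially_approximable M f" "polynomially_approximable M g"
  shows "polynomially_approximable M (\<lambda>z. f z + g z)"
  unfolding polynomially_approximable_def
proof (intro allI impI)
  fix e :: real assume e: "e > 0"
  obtain p q where p: "\<forall>z\<in>M. norm (poly p z - f z) < e / 2" and q: "\<forall>z\<in>M. norm (poly q z - g z) < e / 2"
    using assms e unfolding polynomially_approximable_def by (meson half_gt_zero)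
  have "norm (poly (p + q) z - (f z + g z)) < e" if "z \<in> M" for z
    using norm_triangle_ineq[of "poly p z - f z" "poly q z - g z"] p q that
    by (fastforce simp: algebra_simps)
  then show "\<exists>p. \<forall>z\<in>M. norm (poly p z - (f z + g z)) < e" by blast
qed

lemma polynomially_approximable_bounded:
  assumes "compact M" "polynomially_approximable M f"
  obtains B where "B > 0" "\<And>z. z \<in> M \<Longrightarrow> norm (f z) \<le> B"
proof -
  obtain p where p: "\<forall>z\<in>M. norm (poly p z - f z) < 1"
    using assms(2) unfolding polynomially_approximable_def by (meson zero_less_one)
  have "compact (poly p ` M)" by (intro compact_continuous_image continuous_intros assms)
  then have "bounded (poly p ` M)" by (rule compact_imp_bounded)
  then obtain B where B: "B > 0" "\<forall>z\<in>M. norm (poly p z) \<le> B"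
    unfolding bounded_pos by auto
  show ?thesis
  proof (rule that[of "B + 1"])
    fix z assume z: "z \<in> M"
    have "norm (f z) \<le> norm (poly p z) + norm (f z - poly p z)" by (rule norm_triangle_sub)
    also have "\<dots> \<le> B + 1" using B(2) p z by (intro add_mono) (auto simp: norm_minus_commute intro: less_imp_le)
    finally show "norm (f z) \<le> B + 1" .
  qed (use B in simp)
qed

text \<open>From \<open>p q - f g = (p - f) q + f (q - g)\<close>, bounds for \<open>f\<close> and
  \<open>q\<close> on \<open>M\<close> suffice.\<close>

lemma polynomially_approximable_mult:
  assumes M: "compact M" and "polynomially_approximable M f" "polynomially_approximable M g"
  shows "polynomially_approximable M (\<lambda>z. f z * g z)"
  unfolding polynomially_approximable_def
proof (intro allI impI)
  fix e :: real assume e: "e > 0"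
  obtain B where B: "B > 0" "\<And>z. z \<in> M \<Longrightarrow> norm (f z) \<le> B"
    using polynomially_approximable_bounded[OF M assms(2)] by blast
  \<comment> \<open>\<open>q\<close> comes before \<open>p\<close>, because the tolerance for
    \<open>p\<close> depends on the bound \<open>C\<close> of \<open>q\<close>.\<close>
  obtain q where q: "\<forall>z\<in>M. norm (poly q z - g z) < e / (2 * B)"
    using assms(3)[unfolded polynomially_approximable_def, rule_format, of "e / (2 * B)"] e B(1) by auto
  obtain C where C: "C > 0" "\<And>z. z \<in> M \<Longrightarrow> norm (poly q z) \<le> C"
    using polynomially_approximable_bounded[OF M polynomially_approximable_poly] by blast
  obtain p where p: "\<forall>z\<in>M. norm (poly p z - f z) < e / (2 * C)"
    using assms(2)[unfolded polynomially_approximable_def, rule_format, of "e / (2 * C)"] e C(1) by auto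
  have "norm (poly (p * q) z - f z * g z) < e" if z: "z \<in> M" for z
  proof -
    have "norm ((poly p z - f z) * poly q z) \<le> norm (poly p z - f z) * C"
      unfolding norm_mult using C(2)[OF z] by (intro mult_left_mono) auto
    also have "\<dots> < e / (2 * C) * C" using p z C(1) by (intro mult_strict_right_mono) auto
    also have "\<dots> = e / 2" using C(1) by simp
    finally have 1: "norm ((poly p z - f z) * poly q z) < e / 2" .
    have "norm (f z * (poly q z - g z)) \<le> B * norm (poly q z - g z)"
      unfolding norm_mult using B(2)[OF z] by (intro mult_right_mono) auto
    also have "\<dots> < B * (e / (2 * B))" using q z B(1) by (intro mult_strict_left_mono) auto
    also have "\<dots> = e / 2" using B(1) by simp
    finally have "norm ((poly p z - f z) * poly q z + f z * (poly q z - g z)) < e / 2 + e / 2"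
      using 1 by (intro le_less_trans[OF norm_triangle_ineq] add_strict_mono)
    then show ?thesis by (simp add: algebra_simps)
  qed
  then show "\<exists>p. \<forall>z\<in>M. norm (poly p z - f z * g z) < e" by blast
qed

lemma polynomially_approximable_sum:
  "(\<And>i. i \<in> I \<Longrightarrow> polynomially_approximable M (f i)) \<Longrightarrow> polynomially_approximable M (\<lambda>z. \<Sum>i\<in>I. f i z)"
  by (induction I rule: infinite_finite_induct)
     (auto intro: polynomially_approximable_const polynomially_approximable_add)

lemma polynomially_approximable_prod:
  "compact M \<Longrightarrow> (\<And>i. i \<in> I \<Longrightarrow> polynomially_approximable M (f i)) \<Longrightarrow> polynomially_approximable M (\<lambda>z. \<Prod>i\<in>I. f i z)"
  by (induction I rule: infinite_finite_induct)
     (auto intro: polynomially_approximable_const polynomially_approximable_mult)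

lemma polynomially_approximable_power:
  "compact M \<Longrightarrow> polynomially_approximable M f \<Longrightarrow> polynomially_approximable M (\<lambda>z. f z ^ n)"
  by (induction n) (auto intro: polynomially_approximable_const polynomially_approximable_mult)

text \<open>The geometric series in \<open>f\<close> converges uniformly on \<open>M\<close>, since
  its ratio is bounded by \<open>t < 1\<close>.\<close>

lemma polynomially_approximable_geometric:
  assumes M: "compact M" and f: "polynomially_approximable M f"
    and t: "t < 1" "\<And>z. z \<in> M \<Longrightarrow> norm (f z) \<le> t"
  shows "polynomially_approximable M (\<lambda>z. 1 / (1 - f z))"
proof (rule polynomially_approximable_limit)
  fix e :: real assume e: "e > 0"
  \<comment> \<open>On an empty \<open>M\<close> the bound \<open>t\<close> may be negative; the
    maximum with 0 gives a nonnegative ratio.\<close>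
  define s where "s = max t 0"
  have s: "0 \<le> s" "s < 1" using t(1) by (auto simp: s_def)
  have fs: "norm (f z) \<le> s" if "z \<in> M" for z using t(2)[OF that] by (simp add: s_def)
  obtain n where n: "s ^ n < e * (1 - s)"
    using real_arch_pow_inv[of "e * (1 - s)" s] e s by auto
  show "\<exists>g. polynomially_approximable M g \<and> (\<forall>z\<in>M. norm (g z - 1 / (1 - f z)) < e)"
  proof (intro exI[of _ "\<lambda>z. \<Sum>i<n. f z ^ i"] conjI ballI)
    show "polynomially_approximable M (\<lambda>z. \<Sum>i<n. f z ^ i)"
      by (intro polynomially_approximable_sum polynomially_approximable_power M f)
    fix z assume z: "z \<in> M"
    have ne: "f z \<noteq> 1" using s(2) fs[OF z] by auto
    have "1 - s \<le> norm (1 - f z)" using norm_triangle_ineq2[of 1 "f z"] fs[OF z] by simp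
    have "(\<Sum>i<n. f z ^ i) - 1 / (1 - f z) = - (f z ^ n) / (1 - f z)"
      using ne by (simp add: sum_gp_strict diff_divide_distrib)
    then have "norm ((\<Sum>i<n. f z ^ i) - 1 / (1 - f z)) = norm (f z) ^ n / norm (1 - f z)"
      by (simp add: norm_divide norm_power)
    also have "\<dots> \<le> s ^ n / (1 - s)"
      using s fs \<open>1 - s \<le> norm (1 - f z)\<close> z by (intro frac_le power_mono) auto
    also have "\<dots> < e" using n s by (simp add: field_simps)
    finally show "norm ((\<Sum>i<n. f z ^ i) - 1 / (1 - f z)) < e" .
  qed
qed

text \<open>The Taylor polynomials at 0 converge uniformly on every disc, in particular on one that
  contains \<open>M\<close>.\<close>

lemma polynomially_approximable_entire:
  assumes M: "compact M" and f: "f holomorphic_on UNIV"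
  shows "polynomially_approximable M f"
proof -
  obtain R where R: "\<And>z. z \<in> M \<Longrightarrow> norm z \<le> R"
    using compact_imp_bounded[OF M] unfolding bounded_iff by blast
  define a where "a = (\<lambda>n. (deriv ^^ n) f 0 / fact n)"
  have sums: "(\<lambda>n. a n * (z - 0) ^ n) sums f z" for z
    using holomorphic_power_series[of f 0 "norm z + 1" z] f
    by (auto simp: a_def intro: holomorphic_on_subset)
  have rad: "conv_radius a = \<infinity>"
  proof (rule conv_radius_inftyI'')
    show "summable (\<lambda>n. a n * z ^ n)" for z using sums[of z] by (simp add: sums_iff)
  qed
  have lim: "uniform_limit (cball 0 R) (\<lambda>n x. \<Sum>i<n. a i * (x - 0) ^ i) (\<lambda>x. \<Sum>i. a i * (x - 0) ^ i) sequentially"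
    by (rule powser_uniform_limit) (simp add: rad)
  show ?thesis
  proof (rule polynomially_approximable_limit)
    fix e :: real assume "e > 0"
    with lim have "\<forall>\<^sub>F n in sequentially. \<forall>x\<in>cball 0 R. dist (\<Sum>i<n. a i * (x - 0) ^ i) (\<Sum>i. a i * (x - 0) ^ i) < e"
      by (rule uniform_limitD)
    then obtain n where n: "\<forall>x\<in>cball 0 R. dist (\<Sum>i<n. a i * (x - 0) ^ i) (\<Sum>i. a i * (x - 0) ^ i) < e"
      using eventually_happens'[OF sequentially_bot] by blast
    show "\<exists>g. polynomially_approximable M g \<and> (\<forall>z\<in>M. norm (g z - f z) < e)"
    proof (intro exI[of _ "poly (\<Sum>i<n. monom (a i) i)"] conjI ballI polynomially_approximable_poly)
      fix z assume "z \<in> M"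
      then show "norm (poly (\<Sum>i<n. monom (a i) i) z - f z) < e"
        using bspec[OF n, of z] R[of z] sums_unique[OF sums[of z]]
        by (simp add: poly_sum poly_monom dist_norm)
    qed
  qed
qed

text \<open>Pole pushing: the poles that can be approximated form a relatively clopen subset of \<open>C\<close>.\<close>

lemma polynomially_approximable_pole:
  assumes M: "compact M" and C: "connected C" "C \<inter> M = {}" "\<not> bounded C" and a: "a \<in> C"
  shows "polynomially_approximable M (\<lambda>z. 1 / (z - a))"
proof -
  obtain R where R: "R > 0" "\<And>z. z \<in> M \<Longrightarrow> norm z \<le> R"
    using compact_imp_bounded[OF M] unfolding bounded_pos by blast
  obtain b where b: "b \<in> C" "norm b > 2 * R"
    using C(3) unfolding bounded_iff by (meson not_le)
  show ?thesis
  proof (rule connected_induction_simple[OF C(1) b(1) a])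
    have b0: "b \<noteq> 0" using b(2) R(1) by auto
    \<comment> \<open>For a pole this far away \<open>z / b\<close> has norm at most 1/2 on
      \<open>M\<close>, and \<open>1 / (z - b)\<close> is a geometric series in
      \<open>z / b\<close>.\<close>
    have "polynomially_approximable M (\<lambda>z. (- 1 / b) * (1 / (1 - poly [:0, 1 / b:] z)))"
    proof (intro polynomially_approximable_mult M polynomially_approximable_const
          polynomially_approximable_geometric[where t = "1/2"] polynomially_approximable_poly)
      show "norm (poly [:0, 1 / b:] z) \<le> 1 / 2" if "z \<in> M" for z
      proof -
        have "2 * norm z \<le> norm b" using R(2)[OF that] b(2) by linarith
        then show ?thesis using b0 by (simp add: norm_divide pos_divide_le_eq)
      qed
    qed simp
    also have "?this \<longleftrightarrow> polynomially_approximable M (\<lambda>z. 1 / (z - b))"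
    proof (rule polynomially_approximable_cong)
      fix z assume "z \<in> M"
      then have "z \<noteq> b" using b C(2) by auto
      then show "(- 1 / b) * (1 / (1 - poly [:0, 1 / b:] z)) = 1 / (z - b)"
        using b0 by (simp add: field_simps)
    qed
    finally show "polynomially_approximable M (\<lambda>z. 1 / (z - b))" .
  next
    fix c assume c: "c \<in> C"
    have "open (- M)" using M by (simp add: compact_imp_closed open_Compl)
    moreover have "c \<in> - M" using c C(2) by auto
    ultimately obtain d where d: "d > 0" "ball c d \<subseteq> - M" by (meson openE)
    show "\<exists>T. openin (top_of_set C) T \<and> c \<in> T \<and> (\<forall>x\<in>T. \<forall>y\<in>T.
        polynomially_approximable M (\<lambda>z. 1 / (z - x)) \<longrightarrow> polynomially_approximable M (\<lambda>z. 1 / (z - y)))"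
    \<comment> \<open>The radius \<open>d / 4\<close> gives \<open>|x - y| \<le> d / 2\<close> and
      \<open>|z - x| \<ge> 3 d / 4\<close> for \<open>z\<close> in \<open>M\<close>, hence the ratio
      2/3 below.\<close>
    proof (intro exI[of _ "C \<inter> ball c (d / 4)"] conjI ballI impI)
      show "openin (top_of_set C) (C \<inter> ball c (d / 4))" by (simp add: openin_open_Int)
      show "c \<in> C \<inter> ball c (d / 4)" using c d by simp
      fix x y assume x: "x \<in> C \<inter> ball c (d / 4)" and y: "y \<in> C \<inter> ball c (d / 4)"
        and ap: "polynomially_approximable M (\<lambda>z. 1 / (z - x))"
      \<comment> \<open>The pole moves from \<open>x\<close> to \<open>y\<close> by expanding
        \<open>1 / (z - y)\<close> in powers of \<open>(y - x) / (z - x)\<close>.\<close>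
      have "polynomially_approximable M (\<lambda>z. (1 / (z - x)) * (1 / (1 - (y - x) * (1 / (z - x)))))"
      proof (intro polynomially_approximable_mult M polynomially_approximable_const ap
          polynomially_approximable_geometric[where t = "2/3"])
        fix z assume z: "z \<in> M"
        then have "z \<notin> ball c d" using d(2) by auto
        then have "dist c z \<ge> d" by simp
        moreover have "dist c z \<le> dist c x + dist x z" by (rule dist_triangle)
        moreover have "dist c x < d / 4" "dist c y < d / 4" using x y by auto
        moreover have "dist x y \<le> dist c x + dist c y" by (rule dist_triangle3)
        ultimately have "3 * dist x y \<le> 2 * dist x z" by linarith
        moreover have "z \<noteq> x" using x z C(2) by auto
        ultimately show "norm ((y - x) * (1 / (z - x))) \<le> 2 / 3"
          by (simp add: norm_mult norm_divide dist_norm norm_minus_commute divide_simps)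
      qed simp
      also have "?this \<longleftrightarrow> polynomially_approximable M (\<lambda>z. 1 / (z - y))"
      proof (rule polynomially_approximable_cong)
        fix z assume "z \<in> M"
        then have "z \<noteq> x" "z \<noteq> y" using x y C(2) by auto
        then have "1 - (y - x) * (1 / (z - x)) = (z - y) / (z - x)" by (simp add: field_simps)
        then show "(1 / (z - x)) * (1 / (1 - (y - x) * (1 / (z - x)))) = 1 / (z - y)"
          using \<open>z \<noteq> x\<close> by simp
      qed
      finally show "polynomially_approximable M (\<lambda>z. 1 / (z - y))" .
    qed
  qed
qed

section \<open>Approximating polynomials with prescribed values and conjugation symmetry\<close>

text \<open>Every coefficient is replaced by its real part. The result commutes with conjugation,
  and values that are already symmetric under conjugation are kept.\<close>

definition poly_symm :: "complex poly \<Rightarrow> complex poly" where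
  "poly_symm p = smult (1/2) (p + map_poly cnj p)"

lemma poly_poly_symm: "poly (poly_symm p) z = (poly p z + cnj (poly p (cnj z))) / 2"
  using poly_cnj[of p "cnj z"] by (simp add: poly_symm_def)

lemma poly_symm_cnj: "poly (poly_symm p) (cnj z) = cnj (poly (poly_symm p) z)"
  by (simp add: poly_poly_symm add.commute)

text \<open>The error on \<open>M\<close> is \<open>w^2 (Q - f)\<close> with
  \<open>f = (g - H) / w^2\<close>, so a bound of \<open>w^2\<close> on \<open>M\<close> converts
  closeness of \<open>Q\<close> to \<open>f\<close> into closeness to \<open>g\<close>. On
  \<open>E\<close> only \<open>H\<close> is seen, up to first order.\<close>

lemma polynomial_interpolating_approx:
  fixes g :: "complex \<Rightarrow> complex" and t :: "complex \<Rightarrow> real"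
  assumes M: "compact M" "\<And>z. z \<in> M \<Longrightarrow> cnj z \<in> M"
    and E: "finite E" "\<And>z. z \<in> E \<Longrightarrow> cnj z \<in> E" "E \<inter> M = {}"
    and poles: "\<And>e. e \<in> E \<Longrightarrow> polynomially_approximable M (\<lambda>z. 1 / (z - e))"
    and g: "polynomially_approximable M g" "\<And>z. g (cnj z) = cnj (g z)"
    and t: "\<And>e. t (cnj e) = t e" and d: "d > 0"
  obtains p where "\<And>z. poly p (cnj z) = cnj (poly p z)"
    "\<And>z. z \<in> M \<Longrightarrow> norm (poly p z - g z) < d"
    "\<And>e. e \<in> E \<Longrightarrow> poly p e = of_real (t e)" "\<And>e. e \<in> E \<Longrightarrow> poly (pderiv p) e \<noteq> 0"
proof -
  define w where "w = (\<Prod>e\<in>E. [:- e, 1:])"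
  have w: "poly w z = (\<Prod>e\<in>E. z - e)" for z by (simp add: w_def poly_prod)
  have w_cnj: "poly w (cnj z) = cnj (poly w z)" for z
    unfolding w cnj_prod by (rule prod.reindex_bij_witness[of _ cnj cnj]) (use E(2) in auto)
  have wE: "poly w e = 0" if "e \<in> E" for e using that E(1) by (auto simp: w)
  have wM: "poly w z \<noteq> 0" if "z \<in> M" for z using that E(1,3) by (auto simp: w)
  have w': "poly (pderiv w) e \<noteq> 0" if e: "e \<in> E" for e
  proof -
    define v where "v = (\<Prod>x\<in>E - {e}. [:- x, 1:])"
    have "w = [:- e, 1:] * v" unfolding w_def v_def by (rule prod.remove[OF E(1) e])
    then have "poly (pderiv w) e = poly v e" by (simp only: pderiv_mult) (simp add: pderiv_pCons)
    also have "\<dots> \<noteq> 0" using E(1) by (auto simp: v_def poly_prod)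
    finally show ?thesis .
  qed
  obtain L0 where L0: "\<forall>e\<in>E. poly L0 e = of_real (t e)"
    using poly_interpolation[OF E(1), of "\<lambda>e. e"] by fastforce
  define L where "L = poly_symm L0"
  have L: "poly L e = of_real (t e)" if "e \<in> E" for e
    using L0 that E(2)[OF that] t by (simp add: L_def poly_poly_symm)
  \<comment> \<open>Only finitely many real \<open>c\<close> let the derivative of
    \<open>L + c w\<close> vanish somewhere on \<open>E\<close>; taking \<open>c\<close> real
    preserves the symmetry.\<close>
  obtain c :: real where c: "c \<notin> (\<lambda>e. Re (- poly (pderiv L) e / poly (pderiv w) e)) ` E"
    using ex_new_if_finite[OF infinite_UNIV_char_0, of "(\<lambda>e. Re (- poly (pderiv L) e / poly (pderiv w) e)) ` E"] E(1)
    by blast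
  define H where "H = L + smult (of_real c) w"
  have H': "poly (pderiv H) e \<noteq> 0" if e: "e \<in> E" for e
  proof
    assume "poly (pderiv H) e = 0"
    then have "of_real c * poly (pderiv w) e = - poly (pderiv L) e"
      by (simp add: H_def pderiv_add pderiv_smult eq_neg_iff_add_eq_0 add.commute)
    then have "of_real c = - poly (pderiv L) e / poly (pderiv w) e"
      using w'[OF e] by (simp add: field_simps)
    then have "c = Re (- poly (pderiv L) e / poly (pderiv w) e)" by (metis Re_complex_of_real)
    then show False using c e by blast
  qed
  have H_cnj: "poly H (cnj z) = cnj (poly H z)" for z
    by (simp add: H_def L_def poly_symm_cnj w_cnj)
  define f where "f = (\<lambda>z. (g z - poly H z) / (poly w z)\<^sup>2)"
  have f_cnj: "f (cnj z) = cnj (f z)" for z by (simp add: f_def g(2) H_cnj w_cnj)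
  \<comment> \<open>The factor \<open>1 / w^2\<close> is a product of the simple poles at the points
    of \<open>E\<close>, each taken twice.\<close>
  have "polynomially_approximable M (\<lambda>z. (g z + poly (- H) z) * (\<Prod>e\<in>E. 1 / (z - e)) ^ 2)"
    by (intro polynomially_approximable_mult polynomially_approximable_add polynomially_approximable_power
        polynomially_approximable_prod M g(1) polynomially_approximable_poly poles)
  moreover have "(\<lambda>z. (g z + poly (- H) z) * (\<Prod>e\<in>E. 1 / (z - e)) ^ 2) = f"
    by (simp add: f_def w prod_dividef power_divide)
  ultimately have f: "polynomially_approximable M f" by simp
  obtain B where B: "B > 0" "\<And>z. z \<in> M \<Longrightarrow> norm (poly (w\<^sup>2) z) \<le> B"
    using polynomially_approximable_bounded[OF M(1) polynomially_approximable_poly] by blast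
  obtain Q0 where Q0: "\<forall>z\<in>M. norm (poly Q0 z - f z) < d / B"
    using f[unfolded polynomially_approximable_def, rule_format, of "d / B"] d B(1) by auto
  define Q where "Q = poly_symm Q0"
  have Q: "norm (poly Q z - f z) < d / B" if z: "z \<in> M" for z
  proof -
    have "norm (cnj (poly Q0 (cnj z) - f (cnj z))) < d / B"
      using Q0 M(2)[OF z] by (simp only: complex_mod_cnj)
    then have "norm ((poly Q0 z - f z) + cnj (poly Q0 (cnj z) - f (cnj z))) < d / B + d / B"
      using Q0 z by (intro le_less_trans[OF norm_triangle_ineq add_strict_mono]) blast+
    moreover have "(poly Q0 z - f z) + cnj (poly Q0 (cnj z) - f (cnj z)) = 2 * (poly Q z - f z)"
      by (simp add: Q_def poly_poly_symm f_cnj)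
    ultimately show ?thesis by (simp only: norm_mult) simp
  qed
  show ?thesis
  proof (rule that[of "H + w * (w * Q)"])
    show "poly (H + w * (w * Q)) (cnj z) = cnj (poly (H + w * (w * Q)) z)" for z
      by (simp add: H_cnj w_cnj Q_def poly_symm_cnj)
    show "poly (H + w * (w * Q)) e = of_real (t e)" if "e \<in> E" for e
      using that by (simp add: wE H_def L)
    show "poly (pderiv (H + w * (w * Q))) e \<noteq> 0" if "e \<in> E" for e
      using H'[OF that] by (simp add: pderiv_add pderiv_mult wE[OF that])
    fix z assume z: "z \<in> M"
    have "poly (H + w * (w * Q)) z - g z = poly (w\<^sup>2) z * (poly Q z - f z)"
      using wM[OF z] by (simp add: f_def power2_eq_square field_simps)
    then have "norm (poly (H + w * (w * Q)) z - g z) \<le> B * norm (poly Q z - f z)"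
      using B(2)[OF z] by (simp only: norm_mult) (intro mult_right_mono, auto)
    also have "\<dots> < B * (d / B)" using Q[OF z] B(1) by (intro mult_strict_left_mono) auto
    finally show "norm (poly (H + w * (w * Q)) z - g z) < d" using B(1) by simp
  qed
qed

subsection \<open>The zeros of the zeta function\<close>

lemma holomorphic_zeta: "zeta holomorphic_on -{1}"
  and zeta_sums: "Re s > 1 \<Longrightarrow> (\<lambda>n. 1 / of_nat (Suc n) powr s) sums zeta s"
  and zeta_one: "zeta 1 = 0"
  using zeta_continuation_zeta by (auto simp: zeta_continuation_def)

text \<open>Schwarz reflection: conjugating the series gives another continuation, and the
  continuation is unique.\<close>

lemma zeta_cnj: "zeta (cnj s) = cnj (zeta s)"
proof -
  have "zeta_continuation (\<lambda>s. cnj (zeta (cnj s)))"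
    unfolding zeta_continuation_def
  proof (intro conjI allI impI)
    have "cnj ` (-{1}) = -{1}"
    proof -
      have "x \<in> cnj ` (-{1})" if "x \<noteq> 1" for x
        using that by (intro rev_image_eqI[of "cnj x"]) auto
      then show ?thesis by auto
    qed
    then show "(\<lambda>s. cnj (zeta (cnj s))) holomorphic_on -{1}"
      using holomorphic_on_compose_cnj_cnj[of zeta "-{1}"] holomorphic_zeta by (simp add: o_def open_Compl)
    fix s :: complex assume s: "Re s > 1"
    have "cnj (1 / of_nat (Suc n) powr cnj s) = 1 / of_nat (Suc n) powr s" for n
      by (simp add: powr_def Ln_of_nat exp_cnj del: of_nat_Suc)
    moreover have "(\<lambda>n. cnj (1 / of_nat (Suc n) powr cnj s)) sums cnj (zeta (cnj s))"
      using zeta_sums[of "cnj s"] s by (subst sums_cnj) auto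
    ultimately show "(\<lambda>n. 1 / of_nat (Suc n) powr s) sums cnj (zeta (cnj s))" by simp
  qed (simp add: zeta_one)
  then have "(\<lambda>s. cnj (zeta (cnj s))) = zeta"
    by (rule zeta_continuation_unique[OF _ zeta_continuation_zeta])
  then show ?thesis by (metis complex_cnj_cnj)
qed

text \<open>All terms of the series at 2 are nonnegative and the first one is 1. This rules out that
  \<open>zeta\<close> vanishes identically, and 2 later serves as the point from which all slits
  point away.\<close>

lemma zeta_two_nonzero: "zeta 2 \<noteq> 0"
proof -
  have "(\<lambda>n. Re (1 / of_nat (Suc n) powr 2)) sums Re (zeta 2)"
    using zeta_sums[of 2] by (intro sums_Re) simp
  moreover have "Re (1 / of_nat (Suc n) powr 2) = 1 / real (Suc n) powr 2" for n
  proof -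
    have "1 / of_nat (Suc n) powr 2 = complex_of_real (1 / real (Suc n) powr 2)"
      using powr_of_real[of "real (Suc n)" 2] by (simp del: of_nat_Suc)
    then show ?thesis by (simp only: Re_complex_of_real)
  qed
  ultimately have s: "(\<lambda>n. 1 / real (Suc n) powr 2) sums Re (zeta 2)" by simp
  have "(\<Sum>n\<in>{0}. 1 / real (Suc n) powr 2) \<le> (\<Sum>n. 1 / real (Suc n) powr 2)"
    by (rule sum_le_suminf) (use sums_summable[OF s] in auto)
  then have "Re (zeta 2) \<ge> 1" using sums_unique[OF s] by simp
  then show ?thesis by auto
qed

text \<open>The extension of \<open>(s - 1) * zeta s\<close> to a half-plane containing 1 agrees
  with the product itself off 1, so the two glue to an entire function.\<close>

lemma zeta_entire_part:
  obtains G where "G holomorphic_on UNIV" "\<And>s. s \<noteq> 1 \<Longrightarrow> G s = (s - 1) * zeta s"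
proof -
  let ?S = "{s. Re s > -1}"
  obtain z where z: "z holomorphic_on {s. Re s > 1}"
    "\<And>s. Re s > 1 \<Longrightarrow> (\<lambda>n. of_nat (Suc n) powr (- s)) sums z s"
    using holomorphic_dirichlet_series by blast
  obtain F where F: "F holomorphic_on ?S" "\<And>s. Re s > 1 \<Longrightarrow> F s = (s - 1) * z s"
    \<comment> \<open>Two continuation steps reach \<open>Re s > -1\<close>, a neighbourhood of the
      pole.\<close>
    using zeta_extension_aux[OF z, of 2] by auto
  have z_eq: "z s = zeta s" if "Re s > 1" for s
    using z(2)[OF that] zeta_sums[OF that] by (simp add: powr_minus_divide sums_unique2)
  have F_eq: "F s = (s - 1) * zeta s" if s: "s \<in> ?S - {1}" for s
  proof (rule analytic_continuation_open[of "{s. Re s > 1}" "?S - {1}" F "\<lambda>s. (s - 1) * zeta s"])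
    show "open {s. Re s > 1}" "open (?S - {1})" by (auto intro: open_halfspace_Re_gt open_Diff)
    show "{s. Re s > 1} \<noteq> {}" by (auto intro: exI[of _ 2])
    show "connected (?S - {1})"
      by (intro connected_open_delete open_halfspace_Re_gt convex_connected convex_halfspace_Re_gt) auto
    show "F holomorphic_on ?S - {1}" using F(1) by (rule holomorphic_on_subset) auto
    show "(\<lambda>s. (s - 1) * zeta s) holomorphic_on ?S - {1}"
      by (intro holomorphic_intros holomorphic_on_subset[OF holomorphic_zeta]) auto
  qed (use F(2) z_eq s in auto)
  define G where "G = (\<lambda>s. if s = 1 then F 1 else (s - 1) * zeta s)"
  have "G holomorphic_on ?S \<union> -{1}"
  proof (rule holomorphic_on_Un)
    show "G holomorphic_on ?S"
      by (rule holomorphic_transform[OF F(1)]) (use F_eq in \<open>auto simp: G_def\<close>)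
    have "(\<lambda>s. (s - 1) * zeta s) holomorphic_on -{1}" by (intro holomorphic_intros holomorphic_zeta)
    then show "G holomorphic_on -{1}" by (rule holomorphic_transform) (auto simp: G_def)
  qed (auto intro: open_halfspace_Re_gt)
  moreover have "?S \<union> -{1} = UNIV" by auto
  ultimately show ?thesis using that[of G] by (simp add: G_def)
qed

text \<open>The entire function \<open>(z - 1) * G z\<close> is not constant, so its zeros in a disc
  are finite in number; the factor \<open>z - 1\<close> accounts for the conventional zero of
  \<open>zeta\<close> at 1.\<close>

lemma finite_zeta_zeros: "finite {z \<in> cball 0 R. zeta z = 0}"
proof -
  obtain G where G: "G holomorphic_on UNIV" "\<And>s. s \<noteq> 1 \<Longrightarrow> G s = (s - 1) * zeta s"
    using zeta_entire_part by blast
  have G2: "G 2 \<noteq> 0" using G(2)[of 2] zeta_two_nonzero by simp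
  have "finite {z \<in> cball 0 R. (z - 1) * G z = 0}"
  proof (rule holomorphic_compact_finite_zeros[of _ UNIV])
    show "\<not> (\<lambda>z. (z - 1) * G z) constant_on UNIV"
    proof
      assume "(\<lambda>z. (z - 1) * G z) constant_on UNIV"
      then have "(2 - 1) * G 2 = (1 - 1) * G 1" unfolding constant_on_def by (metis UNIV_I)
      then show False using G2 by simp
    qed
  qed (use G in \<open>auto intro!: holomorphic_intros\<close>)
  then show ?thesis by (rule finite_subset[rotated]) (auto simp: G(2), metis G(2) mult_zero_right)
qed

section \<open>Slits that shrink to the zeros and the pole\<close>

text \<open>A half-strip around the ray from 1 to the right, with the reals
  \<open>u \<ge> 1 + h\<close> left out. If they stayed, every real \<open>u > 1\<close> would lie
  in all slits, which would not shrink to the point 1. The channels beside the omitted ray still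
  lead to infinity.\<close>

definition slit :: "real \<Rightarrow> complex set" where
  "slit h = {u. 1 - h < Re u \<and> \<bar>Im u\<bar> < h \<and> (Im u \<noteq> 0 \<or> Re u < 1 + h)}"

lemma open_slit: "open (slit h)"
  unfolding slit_def
  by (intro open_Collect_conj open_Collect_disj open_Collect_less open_Collect_neq continuous_intros)

lemma slit_mono: "h \<le> h' \<Longrightarrow> slit h \<subseteq> slit h'"
  by (auto simp: slit_def)

lemma one_in_slit: "h > 0 \<Longrightarrow> 1 \<in> slit h"
  by (simp add: slit_def)

lemma cnj_in_slit_iff: "cnj u \<in> slit h \<longleftrightarrow> u \<in> slit h"
  by (simp add: slit_def)

text \<open>A box around 1, joined to the channel above the omitted ray, is a route along which a
  pole at 1 can be pushed to infinity.\<close>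

lemma slit_escape:
  assumes "h > 0"
  obtains C where "connected C" "1 \<in> C" "C \<subseteq> slit h" "\<not> bounded C"
proof
  let ?A = "{u. 1 - h < Re u \<and> Re u < 1 + h \<and> \<bar>Im u\<bar> < h}"
  let ?B = "{u. 1 - h < Re u \<and> 0 < Im u \<and> Im u < h}"
  have "?A = {u. Re u > 1 - h} \<inter> {u. Re u < 1 + h} \<inter> {u. Im u > - h} \<inter> {u. Im u < h}" by auto
  then have "convex ?A"
    by (simp only:) (intro convex_Int convex_halfspace_Re_gt convex_halfspace_Re_lt
        convex_halfspace_Im_gt convex_halfspace_Im_lt)
  moreover have "?B = {u. Re u > 1 - h} \<inter> {u. Im u > 0} \<inter> {u. Im u < h}" by auto
  then have "convex ?B"
    by (simp only:) (intro convex_Int convex_halfspace_Re_gt convex_halfspace_Re_lt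
        convex_halfspace_Im_gt convex_halfspace_Im_lt)
  moreover have "Complex 1 (h / 2) \<in> ?A \<inter> ?B" using assms by simp
  ultimately show "connected (?A \<union> ?B)"
    by (intro connected_Un convex_connected) blast+
  show "1 \<in> ?A \<union> ?B" using assms by simp
  show "?A \<union> ?B \<subseteq> slit h" by (auto simp: slit_def)
  show "\<not> bounded (?A \<union> ?B)"
  proof
    assume "bounded (?A \<union> ?B)"
    then obtain b where b: "\<And>u. u \<in> ?A \<union> ?B \<Longrightarrow> norm u \<le> b" unfolding bounded_iff by blast
    have "Complex (\<bar>b\<bar> + 2) (h / 2) \<in> ?A \<union> ?B" using assms by auto
    from b[OF this] abs_Re_le_cmod[of "Complex (\<bar>b\<bar> + 2) (h / 2)"] show False by simp
  qed
qed

text \<open>A nonreal \<open>u\<close> is outside once the width is below \<open>|Im u|\<close>, a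
  real one once it is below \<open>|u - 1|\<close>.\<close>

lemma slit_shrink:
  assumes "u \<noteq> 1"
  shows "\<forall>\<^sub>F n in sequentially. u \<notin> slit (1 / real (Suc n))"
proof -
  have lim: "(\<lambda>n. 1 / real (Suc n)) \<longlonglongrightarrow> 0" by (rule LIMSEQ_Suc[OF lim_1_over_n])
  have "0 < (if Im u = 0 then \<bar>Re u - 1\<bar> else \<bar>Im u\<bar>)" using assms by (auto simp: complex_eq_iff)
  from order_tendstoD(2)[OF lim this] show ?thesis
    by eventually_elim (auto simp: slit_def abs_if split: if_splits simp del: of_nat_Suc)
qed

text \<open>The slits point away from \<open>2\<close>, which is not a zero, so that only the finitely many zeros
  \<open>e\<close> with \<open>|e - 2| < 2 |z - 2|\<close> have slits meeting a given \<open>z\<close>.\<close>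

definition zero_slit :: "nat \<Rightarrow> complex \<Rightarrow> complex set" where
  "zero_slit n e = {z. (z - 2) / (e - 2) \<in> slit (1 / real (Suc n))}"

text \<open>By the convention \<open>zeta 1 = 0\<close> the union contains a slit at the pole 1 as
  well.\<close>

definition slit_disc :: "nat \<Rightarrow> complex set" where
  "slit_disc n = cball 0 (real n) - (\<Union>e\<in>{e. zeta e = 0}. zero_slit n e)"

lemma open_zero_slit: "e \<noteq> 2 \<Longrightarrow> open (zero_slit n e)"
  using open_vimage[OF open_slit, of "\<lambda>z. (z - 2) / (e - 2)"]
  by (simp add: zero_slit_def vimage_def continuous_intros)

lemma compact_slit_disc: "compact (slit_disc n)"
  unfolding slit_disc_def
  by (intro compact_diff compact_cball open_UN ballI open_zero_slit) (use zeta_two_nonzero in auto)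

lemma zeta_nonzero_slit_disc: "z \<in> slit_disc n \<Longrightarrow> zeta z \<noteq> 0"
proof
  assume z: "z \<in> slit_disc n" "zeta z = 0"
  then have "z \<noteq> 2" using zeta_two_nonzero by auto
  then have "z \<in> zero_slit n z" by (simp add: zero_slit_def one_in_slit)
  then show False using z by (auto simp: slit_disc_def)
qed

text \<open>The point 2 is real and the model slit is symmetric, so the slit of \<open>cnj e\<close>
  mirrors the slit of \<open>e\<close>; the zeros are symmetric by \<open>zeta_cnj\<close>.\<close>

lemma cnj_slit_disc:
  assumes "z \<in> slit_disc n"
  shows "cnj z \<in> slit_disc n"
proof -
  have "z \<in> zero_slit n (cnj e)" if "cnj z \<in> zero_slit n e" for e
    using that cnj_in_slit_iff[of "(cnj z - 2) / (e - 2)"] by (simp add: zero_slit_def)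
  then show ?thesis using assms by (auto simp: slit_disc_def) (metis complex_cnj_zero zeta_cnj)
qed

lemma slit_disc_mono: "slit_disc n \<subseteq> slit_disc (Suc n)"
proof -
  have "1 / real (Suc (Suc n)) \<le> 1 / real (Suc n)" by (simp add: frac_le)
  then have "zero_slit (Suc n) e \<subseteq> zero_slit n e" for e
    using slit_mono unfolding zero_slit_def by blast
  then show ?thesis unfolding slit_disc_def by fastforce
qed

lemma slit_disc_exhausts:
  assumes z: "zeta z \<noteq> 0"
  shows "\<exists>n\<ge>1. z \<in> slit_disc n"
proof -
  \<comment> \<open>If \<open>z\<close> lies in the slit of \<open>e\<close> and
    \<open>n \<ge> 1\<close>, then \<open>|e - 2| < 2 |z - 2|\<close>, so \<open>F\<close> contains
    every zero whose slit can meet \<open>z\<close>.\<close>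
  define F where "F = {e \<in> cball 0 (2 * norm (z - 2) + 2). zeta e = 0}"
  have "finite F" unfolding F_def by (rule finite_zeta_zeros)
  moreover have "\<forall>\<^sub>F n in sequentially. z \<notin> zero_slit n e" if "e \<in> F" for e
    unfolding zero_slit_def mem_Collect_eq
    by (rule slit_shrink) (use that z zeta_two_nonzero in \<open>auto simp: F_def divide_simps split: if_splits\<close>)
  ultimately have "\<forall>\<^sub>F n in sequentially. \<forall>e\<in>F. z \<notin> zero_slit n e" by (simp add: eventually_ball_finite)
  moreover have "\<forall>\<^sub>F n in sequentially. norm z \<le> real n"
    using eventually_ge_at_top[of "nat \<lceil>norm z\<rceil>"] by eventually_elim linarith
  ultimately have "\<forall>\<^sub>F n in sequentially. (\<forall>e\<in>F. z \<notin> zero_slit n e) \<and> norm z \<le> real n \<and> n \<ge> 1"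
    using eventually_ge_at_top[of 1] by eventually_elim auto
  then obtain n where n: "\<forall>e\<in>F. z \<notin> zero_slit n e" "norm z \<le> real n" "n \<ge> 1"
    using eventually_happens'[OF sequentially_bot] by blast
  have "z \<notin> zero_slit n e" if e: "zeta e = 0" for e
  proof
    assume slit: "z \<in> zero_slit n e"
    have e2: "norm (e - 2) > 0" using e zeta_two_nonzero by auto
    have "1 - 1 / real (Suc n) < Re ((z - 2) / (e - 2))" using slit by (simp add: zero_slit_def slit_def)
    also have "\<dots> \<le> norm ((z - 2) / (e - 2))" by (rule complex_Re_le_cmod)
    finally have "1 - 1 / real (Suc n) < norm (z - 2) / norm (e - 2)" by (simp add: norm_divide)
    moreover have "1 / real (Suc n) \<le> 1 / 2" using n(3) by (intro divide_left_mono) auto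
    ultimately have "1 / 2 < norm (z - 2) / norm (e - 2)" by linarith
    then have "norm (e - 2) < 2 * norm (z - 2)" using e2 by (simp add: field_simps)
    moreover have "norm e \<le> norm (e - 2) + 2" using norm_triangle_ineq[of "e - 2" 2] by simp
    ultimately have "e \<in> F" using e by (simp add: F_def)
    then show False using n(1) slit by blast
  qed
  then show ?thesis using n by (auto simp: slit_disc_def)
qed

lemma polynomially_approximable_zeta_zero_pole:
  assumes e: "zeta e = 0"
  shows "polynomially_approximable (slit_disc n) (\<lambda>z. 1 / (z - e))"
proof -
  have e2: "e - 2 \<noteq> 0" using e zeta_two_nonzero by auto
  obtain C where C: "connected C" "1 \<in> C" "C \<subseteq> slit (1 / real (Suc n))" "\<not> bounded C"
    by (rule slit_escape[of "1 / real (Suc n)"]) auto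
  \<comment> \<open>The affine map taking 0 to 2 and 1 to \<open>e\<close> carries the escape route
    of the model slit into the slit of \<open>e\<close>.\<close>
  let ?C = "(\<lambda>u. 2 + (e - 2) * u) ` C"
  show ?thesis
  proof (rule polynomially_approximable_pole[where C = ?C])
    show "compact (slit_disc n)" by (rule compact_slit_disc)
    show "connected ?C" by (intro connected_continuous_image continuous_intros C)
    have "?C \<subseteq> zero_slit n e" using C(3) e2 by (auto simp: zero_slit_def)
    then show "?C \<inter> slit_disc n = {}" using e by (auto simp: slit_disc_def)
    show "e \<in> ?C" using C(2) by (intro rev_image_eqI[of 1]) auto
    show "\<not> bounded ?C"
    proof
      assume "bounded ?C"
      then obtain b where b: "\<And>u. u \<in> C \<Longrightarrow> norm (2 + (e - 2) * u) \<le> b" unfolding bounded_iff by blast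
      have "norm u \<le> (b + 2) / norm (e - 2)" if "u \<in> C" for u
      proof -
        have "norm ((e - 2) * u) \<le> b + 2"
          using norm_triangle_ineq4[of "2 + (e - 2) * u" 2] b[OF that] by simp
        then show ?thesis using e2 by (simp add: norm_mult pos_le_divide_eq mult.commute)
      qed
      then show False using C(4) unfolding bounded_iff by blast
    qed
  qed
qed

text \<open>On the slit disc \<open>zeta\<close> is an entire function times the approximable pole
  \<open>1 / (z - 1)\<close>.\<close>

lemma polynomially_approximable_zeta: "polynomially_approximable (slit_disc n) zeta"
proof -
  obtain G where G: "G holomorphic_on UNIV" "\<And>s. s \<noteq> 1 \<Longrightarrow> G s = (s - 1) * zeta s"
    using zeta_entire_part by blast
  have "polynomially_approximable (slit_disc n) (\<lambda>z. G z * (1 / (z - 1)))"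
    by (intro polynomially_approximable_mult compact_slit_disc polynomially_approximable_entire G(1)
        polynomially_approximable_zeta_zero_pole zeta_one)
  also have "?this \<longleftrightarrow> polynomially_approximable (slit_disc n) zeta"
  proof (rule polynomially_approximable_cong)
    fix z assume "z \<in> slit_disc n"
    then have "z \<noteq> 1" using zeta_nonzero_slit_disc zeta_one by blast
    then show "G z * (1 / (z - 1)) = zeta z" by (simp add: G(2))
  qed
  finally show ?thesis .
qed

subsection \<open>The approximants\<close>

text \<open>Collects the requirements on one function, so that polynomials and Dirichlet polynomials
  are treated alike. The condition \<open>z \<noteq> 1\<close> discards the conventional zero of
  \<open>zeta\<close> at its pole; \<open>zorder f z = 1\<close> expresses simplicity.\<close>

definition good_approximant :: "nat \<Rightarrow> complex set \<Rightarrow> (complex \<Rightarrow> complex) \<Rightarrow> bool" where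
  "good_approximant n K f \<longleftrightarrow>
     (\<forall>z\<in>K - {1}. norm (f z - zeta z) \<le> 1 / real n) \<and> f 1 = of_nat n \<and>
     (\<forall>z\<in>K \<inter> (\<real> \<union> critical_line). f z = 0 \<longrightarrow> zorder f z = 1) \<and>
     {z \<in> K \<inter> (\<real> \<union> critical_line). f z = 0} =
       {z \<in> K \<inter> (\<real> \<union> critical_line). z \<noteq> 1 \<and> zeta z = 0} \<and>
     (\<forall>z\<in>K - (\<real> \<union> critical_line). f z \<noteq> 0) \<and>
     f ` \<real> \<subseteq> \<real>"

text \<open>Zeros on the real axis and the critical line are kept; the other zeros get the value \<open>1/n\<close>,
  which is possible because every zero is an isolated point of the compact set.\<close>

definition prescribed_value :: "nat \<Rightarrow> complex \<Rightarrow> real" where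
  "prescribed_value n e = (if e = 1 then real n else if e \<in> \<real> \<union> critical_line then 0 else 1 / real n)"

text \<open>For \<open>n \<ge> 1\<close> this includes the pole 1, by the convention
  \<open>zeta 1 = 0\<close>, so that a value is prescribed there too.\<close>

definition zeros_in_disc :: "nat \<Rightarrow> complex set" where
  "zeros_in_disc n = {z \<in> cball 0 (real n). zeta z = 0}"

text \<open>Where \<open>|f - zeta| < d \<le> |zeta|\<close>, \<open>f\<close> cannot vanish, so its
  zeros in the compact set are among the isolated points, and there the nonzero derivative makes
  them simple. The symmetry gives real values on the real axis.\<close>

lemma good_approximantI:
  assumes n: "n \<ge> 1" and f: "f holomorphic_on UNIV" "\<And>z. f (cnj z) = cnj (f z)"
    and d: "d \<le> 1 / real n" "\<And>z. z \<in> slit_disc n \<Longrightarrow> d \<le> norm (zeta z)"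
    and close: "\<And>z. z \<in> slit_disc n \<Longrightarrow> norm (f z - zeta z) < d"
    and val: "\<And>e. e \<in> zeros_in_disc n \<Longrightarrow> f e = of_real (prescribed_value n e)"
    and der: "\<And>e. e \<in> zeros_in_disc n \<Longrightarrow> deriv f e \<noteq> 0"
  shows "good_approximant n (slit_disc n \<union> zeros_in_disc n) f"
proof -
  have one: "1 \<in> zeros_in_disc n" using n by (simp add: zeros_in_disc_def zeta_one)
  have nz: "f z \<noteq> 0" if "z \<in> slit_disc n" for z
    using close[OF that] d(2)[OF that] by auto
  show ?thesis
    unfolding good_approximant_def
  proof (intro conjI ballI impI)
    show "f 1 = of_nat n" using val[OF one] by (simp add: prescribed_value_def)
    show "f ` \<real> \<subseteq> \<real>"
    proof safe
      fix z :: complex assume "z \<in> \<real>"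
      then have "cnj (f z) = f z" by (metis Reals_cnj_iff f(2))
      then show "f z \<in> \<real>" by (simp add: Reals_cnj_iff)
    qed
    show "{z \<in> (slit_disc n \<union> zeros_in_disc n) \<inter> (\<real> \<union> critical_line). f z = 0} =
       {z \<in> (slit_disc n \<union> zeros_in_disc n) \<inter> (\<real> \<union> critical_line). z \<noteq> 1 \<and> zeta z = 0}"
      using nz n val zeta_nonzero_slit_disc
      by (auto simp: prescribed_value_def zeros_in_disc_def split: if_splits)
  next
    fix z assume z: "z \<in> (slit_disc n \<union> zeros_in_disc n) - {1}"
    show "norm (f z - zeta z) \<le> 1 / real n"
    proof (cases "z \<in> slit_disc n")
      case True
      then show ?thesis using close[OF True] d(1) by linarith
    next
      case False
      then have "z \<in> zeros_in_disc n" using z by blast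
      moreover from this have "zeta z = 0" by (simp add: zeros_in_disc_def)
      \<comment> \<open>Away from 1 the prescribed value is 0 or \<open>1 / n\<close>, hence within
        the tolerance.\<close>
      ultimately show ?thesis using z val[of z] by (auto simp: prescribed_value_def norm_divide)
    qed
  next
    fix z assume z: "z \<in> (slit_disc n \<union> zeros_in_disc n) \<inter> (\<real> \<union> critical_line)" "f z = 0"
    then have "deriv f z \<noteq> 0" using nz der by blast
    then show "zorder f z = 1"
      using z(2) by (intro zorder_zero_eqI[OF f(1)]) auto
  next
    fix z assume z: "z \<in> slit_disc n \<union> zeros_in_disc n - (\<real> \<union> critical_line)"
    then show "f z \<noteq> 0" using nz val[of z] n by (auto simp: prescribed_value_def split: if_splits)
  qed
qed

text \<open>Composing \<open>p\<close> with a Dirichlet polynomial \<open>\<phi>\<close> near the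
  identity changes \<open>p\<close> little by uniform continuity; the derivative on \<open>E\<close>
  stays nonzero by the chain rule, as the derivative of \<open>\<phi>\<close> there is near
  1.\<close>

lemma dirichlet_polynomial_near_poly:
  fixes p :: "complex poly"
  assumes E: "finite E" "E \<subseteq> cball 0 R" "cnj ` E \<subseteq> E" and R: "R \<ge> 0" and d: "d > 0"
    and p: "\<And>z. poly p (cnj z) = cnj (poly p z)" and p': "\<And>e. e \<in> E \<Longrightarrow> poly (pderiv p) e \<noteq> 0"
  obtains D where "dirichlet_polynomial D" "\<And>z. D (cnj z) = cnj (D z)"
    "\<And>z. norm z \<le> R \<Longrightarrow> norm (D z - poly p z) < d"
    "\<And>e. e \<in> E \<Longrightarrow> D e = poly p e" "\<And>e. e \<in> E \<Longrightarrow> deriv D e \<noteq> 0"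
proof -
  \<comment> \<open>The larger radius leaves room for \<open>\<phi> z\<close>, which lies within 1/2
    of \<open>z\<close>.\<close>
  have "uniformly_continuous_on (cball 0 (R + 2)) (poly p)"
    by (intro compact_uniformly_continuous continuous_intros compact_cball)
  then obtain h where h: "h > 0" "\<And>x y. x \<in> cball 0 (R + 2) \<Longrightarrow> y \<in> cball 0 (R + 2) \<Longrightarrow>
      dist y x < h \<Longrightarrow> dist (poly p y) (poly p x) < d"
    using d unfolding uniformly_continuous_on_def by metis
  have "E \<subseteq> cball 0 (R + 1)" using E(2) by auto
  moreover have "min h (1 / 2) > 0" "R + 1 > 0" using h(1) R by auto
  ultimately obtain \<phi> where \<phi>: "dirichlet_polynomial \<phi>"
      "\<And>z. norm z \<le> R + 1 \<Longrightarrow> norm (\<phi> z - z) < min h (1 / 2)"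
      "\<And>x. x \<in> E \<Longrightarrow> \<phi> x = x" "\<And>z. \<phi> (cnj z) = cnj (\<phi> z)"
    using dirichlet_interpolating_approx[OF E(1) _ E(3), of "R + 1" "min h (1 / 2)"] by metis
  have hol: "\<phi> holomorphic_on A" for A by (rule holomorphic_dirichlet_polynomial[OF \<phi>(1)])
  show ?thesis
  proof (rule that[of "\<lambda>z. poly p (\<phi> z)"])
    show "dirichlet_polynomial (\<lambda>z. poly p (\<phi> z))" by (rule dirichlet_polynomial_poly[OF \<phi>(1)])
    show "poly p (\<phi> (cnj z)) = cnj (poly p (\<phi> z))" for z by (simp add: \<phi>(4) p)
    show "poly p (\<phi> e) = poly p e" if "e \<in> E" for e by (simp add: \<phi>(3) that)
    show "norm (poly p (\<phi> z) - poly p z) < d" if z: "norm z \<le> R" for z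
    proof -
      have c: "norm (\<phi> z - z) < h" "norm (\<phi> z - z) < 1 / 2" using \<phi>(2)[of z] z by auto
      have "norm (\<phi> z) \<le> norm z + norm (\<phi> z - z)" by (rule norm_triangle_sub)
      then show ?thesis using h(2)[of z "\<phi> z"] c z by (simp add: dist_norm)
    qed
    show "deriv (\<lambda>z. poly p (\<phi> z)) e \<noteq> 0" if e: "e \<in> E" for e
    proof -
      have d\<phi>: "(\<phi> has_field_derivative deriv \<phi> e) (at e)"
        using hol[of UNIV] by (intro holomorphic_derivI[of _ UNIV]) auto
      \<comment> \<open>Cauchy's inequality on the unit circle around \<open>e\<close>, which lies
        in the disc of radius \<open>R + 1\<close>, gives
        \<open>|deriv \<phi> e - 1| \<le> 1/2\<close>.\<close>
      have "norm ((deriv ^^ 1) (\<lambda>z. \<phi> z - z) e) \<le> fact 1 * (1 / 2) / 1 ^ 1"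
      proof (rule Cauchy_inequality)
        show "(\<lambda>z. \<phi> z - z) holomorphic_on ball e 1" by (intro holomorphic_intros hol)
        show "continuous_on (cball e 1) (\<lambda>z. \<phi> z - z)"
          by (intro continuous_intros holomorphic_on_imp_continuous_on hol)
        fix x assume "norm (e - x) = 1"
        moreover have "norm e \<le> R" using e E(2) by auto
        moreover have "norm x \<le> norm e + norm (x - e)" by (rule norm_triangle_sub)
        ultimately have "norm x \<le> R + 1" by (simp add: norm_minus_commute)
        from \<phi>(2)[OF this] show "norm (\<phi> x - x) \<le> 1 / 2" by simp
      qed simp
      moreover have "deriv (\<lambda>z. \<phi> z - z) e = deriv \<phi> e - 1"
        by (intro DERIV_imp_deriv DERIV_diff d\<phi> DERIV_ident)
      ultimately have "deriv \<phi> e \<noteq> 0" by auto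
      moreover have "((\<lambda>z. poly p (\<phi> z)) has_field_derivative poly (pderiv p) (\<phi> e) * deriv \<phi> e) (at e)"
        by (rule DERIV_chain2[OF poly_DERIV d\<phi>])
      then have "deriv (\<lambda>z. poly p (\<phi> z)) e = poly (pderiv p) e * deriv \<phi> e"
        using \<phi>(3)[OF e] by (simp add: DERIV_imp_deriv)
      ultimately show ?thesis using p'[OF e] by simp
    qed
  qed
qed

lemma good_approximants_exist:
  assumes n: "n \<ge> 1"
  shows "\<exists>p D. dirichlet_polynomial D \<and> (\<forall>f\<in>{poly p, D}. good_approximant n (slit_disc n \<union> zeros_in_disc n) f)"
proof -
  have "\<exists>d>0. \<forall>z\<in>slit_disc n. d \<le> norm (zeta z)"
  proof (cases "slit_disc n = {}")
    case False
    have "slit_disc n \<subseteq> - {1}" using zeta_nonzero_slit_disc zeta_one by auto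
    then have "continuous_on (slit_disc n) (\<lambda>z. norm (zeta z))"
      by (intro continuous_on_norm holomorphic_on_imp_continuous_on holomorphic_on_subset[OF holomorphic_zeta])
    from continuous_attains_inf[OF compact_slit_disc False this] show ?thesis
      using zeta_nonzero_slit_disc by (metis zero_less_norm_iff)
  qed (auto intro: exI[of _ 1])
  then obtain d0 where d0: "d0 > 0" "\<And>z. z \<in> slit_disc n \<Longrightarrow> d0 \<le> norm (zeta z)" by blast
  \<comment> \<open>At most the lower bound of \<open>|zeta|\<close> on the slit disc and at most
    the tolerance; one half is spent on the polynomial, the other on the passage to the Dirichlet
    polynomial.\<close>
  define d where "d = min d0 (1 / real n)"
  have d: "d > 0" "d \<le> 1 / real n" "\<And>z. z \<in> slit_disc n \<Longrightarrow> d \<le> norm (zeta z)"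
    using d0 n by (auto simp: d_def intro: min.coboundedI1)
  let ?E = "zeros_in_disc n"
  have fin: "finite ?E" unfolding zeros_in_disc_def by (rule finite_zeta_zeros)
  have Ec: "cnj z \<in> ?E" if "z \<in> ?E" for z using that by (simp add: zeros_in_disc_def zeta_cnj)
  have disj: "?E \<inter> slit_disc n = {}" using zeta_nonzero_slit_disc by (auto simp: zeros_in_disc_def)
  have t: "prescribed_value n (cnj e) = prescribed_value n e" for e
    by (auto simp: prescribed_value_def critical_line_def complex_is_Real_iff)
  have poles: "polynomially_approximable (slit_disc n) (\<lambda>z. 1 / (z - e))" if "e \<in> ?E" for e
    using that by (intro polynomially_approximable_zeta_zero_pole) (simp add: zeros_in_disc_def)
  obtain p where p: "\<And>z. poly p (cnj z) = cnj (poly p z)"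
    "\<And>z. z \<in> slit_disc n \<Longrightarrow> norm (poly p z - zeta z) < d / 2"
    "\<And>e. e \<in> ?E \<Longrightarrow> poly p e = of_real (prescribed_value n e)" "\<And>e. e \<in> ?E \<Longrightarrow> poly (pderiv p) e \<noteq> 0"
    using polynomial_interpolating_approx[where g = zeta and t = "prescribed_value n", OF compact_slit_disc cnj_slit_disc fin Ec disj poles
        polynomially_approximable_zeta zeta_cnj t half_gt_zero[OF d(1)]] by blast
  have sub: "?E \<subseteq> cball 0 (real n)" and "cnj ` ?E \<subseteq> ?E" using Ec by (auto simp: zeros_in_disc_def)
  from dirichlet_polynomial_near_poly[OF fin this _ half_gt_zero[OF d(1)] p(1,4)]
  obtain D where D: "dirichlet_polynomial D" "\<And>z. D (cnj z) = cnj (D z)"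
    "\<And>z. norm z \<le> real n \<Longrightarrow> norm (D z - poly p z) < d / 2"
    "\<And>e. e \<in> ?E \<Longrightarrow> D e = poly p e" "\<And>e. e \<in> ?E \<Longrightarrow> deriv D e \<noteq> 0" by auto
  have "good_approximant n (slit_disc n \<union> ?E) (poly p)"
  proof (rule good_approximantI[OF n _ p(1) d(2,3) _ p(3)])
    show "poly p holomorphic_on UNIV" by (intro holomorphic_intros)
    show "norm (poly p z - zeta z) < d" if "z \<in> slit_disc n" for z using p(2)[OF that] d(1) by simp
    show "deriv (poly p) e \<noteq> 0" if "e \<in> ?E" for e
      using p(4)[OF that] by (simp add: DERIV_imp_deriv[OF poly_DERIV])
  qed
  moreover have "good_approximant n (slit_disc n \<union> ?E) D"
  proof (rule good_approximantI[OF n holomorphic_dirichlet_polynomial[OF D(1)] D(2) d(2,3) _ _ D(5)])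
    show "norm (D z - zeta z) < d" if z: "z \<in> slit_disc n" for z
    proof -
      have "norm z \<le> real n" using z by (simp add: slit_disc_def)
      then have "norm ((D z - poly p z) + (poly p z - zeta z)) < d / 2 + d / 2"
        using D(3) p(2)[OF z] by (intro le_less_trans[OF norm_triangle_ineq add_strict_mono])
      then show ?thesis by simp
    qed
    show "D e = of_real (prescribed_value n e)" if "e \<in> ?E" for e using D(4) p(3) that by simp
  qed
  ultimately show ?thesis using D(1) by blast
qed

theorem theorem1:
  shows "\<exists>(K :: nat \<Rightarrow> complex set) (P :: nat \<Rightarrow> complex poly) (D :: nat \<Rightarrow> complex \<Rightarrow> complex).
    (\<forall>n\<ge>1. compact (K n)) \<and>
    (\<forall>n\<ge>1. K n \<subseteq> K (n + 1)) \<and>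
    (\<Union>n\<in>{1..}. K n) = UNIV \<and>
    (\<forall>n\<ge>1. dirichlet_polynomial (D n)) \<and>
    (\<forall>n\<ge>1.
       (\<forall>z\<in>K n - {1}.
          max (norm (poly (P n) z - zeta z)) (norm (D n z - zeta z)) \<le> 1 / real n) \<and>
       poly (P n) 1 = of_nat n \<and> D n 1 = of_nat n \<and>
       (\<forall>f\<in>{poly (P n), D n}.
          (\<forall>z\<in>K n \<inter> (\<real> \<union> critical_line). f z = 0 \<longrightarrow> zorder f z = 1) \<and>
          {z \<in> K n \<inter> (\<real> \<union> critical_line). f z = 0} =
            {z \<in> K n \<inter> (\<real> \<union> critical_line). z \<noteq> 1 \<and> zeta z = 0} \<and>
          (\<forall>z\<in>K n - (\<real> \<union> critical_line). f z \<noteq> 0) \<and>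
          f ` \<real> \<subseteq> \<real>))"
proof -
  define K where "K = (\<lambda>n. slit_disc n \<union> zeros_in_disc n)"
  have "\<forall>n\<ge>1. \<exists>p D. dirichlet_polynomial D \<and> (\<forall>f\<in>{poly p, D}. good_approximant n (K n) f)"
    unfolding K_def using good_approximants_exist by blast
  then obtain P D where PD: "\<And>n. n \<ge> 1 \<Longrightarrow> dirichlet_polynomial (D n)"
    "\<And>n f. n \<ge> 1 \<Longrightarrow> f \<in> {poly (P n), D n} \<Longrightarrow> good_approximant n (K n) f" by metis
  have "compact (K n)" for n
    unfolding K_def zeros_in_disc_def
    by (intro compact_Un compact_slit_disc finite_imp_compact finite_zeta_zeros)
  moreover have "K n \<subseteq> K (n + 1)" for n
    using slit_disc_mono[of n] by (auto simp: K_def zeros_in_disc_def)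
  moreover have "(\<Union>n\<in>{1..}. K n) = UNIV"
  proof -
    \<comment> \<open>A zero enters as an isolated point once the disc reaches it; any other point
      is eventually released by the shrinking slits.\<close>
    have "\<exists>n\<ge>1. z \<in> K n" for z
    proof (cases "zeta z = 0")
      case True
      then have "z \<in> K (max 1 (nat \<lceil>norm z\<rceil>))"
        by (auto simp: K_def zeros_in_disc_def) linarith
      then show ?thesis using max.cobounded1 by blast
    next
      case False
      then show ?thesis using slit_disc_exhausts unfolding K_def by blast
    qed
    then show ?thesis by auto
  qed
  moreover have "\<forall>n\<ge>1. \<forall>f\<in>{poly (P n), D n}. good_approximant n (K n) f" using PD(2) by blast
  ultimately show ?thesis
    using PD(1) unfolding good_approximant_def
    by (intro exI[of _ K] exI[of _ P] exI[of _ D] conjI) (auto simp only: max.bounded_iff ball_simps simp_thms image_subset_iff)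
qed

end
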